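(* Let $1\le p\le\infty$, $\beta\in\mathbb{R}$, $r>1$ and $n\in\mathbb{N}$ satisfy $$\sqrt{n}+1\le r\le n+1 .$$ Then for $1\le p<\infty$ $$\mathcal{E}_n(W^r_{\beta,1})_{L_p}=n^{-r}\Big(\frac{\|\cos t\|_{p}}{\pi}\,F^{\frac1{p}}\Big(\frac{p}{2},\frac{p}{2};1;e^{-2r/n}\Big)+O(1)\,n\,r^{-2}\Big),$$ and for $p=\infty$ $$\mathcal{E}_n(W^r_{\beta,1})_{L_\infty}=n^{-r}\Big(\frac{1}{\pi(1-e^{-r/n})}+O(1)\,n\,r^{-2}\Big),$$ where the quantities $O(1)$ are uniformly bounded with respect to all parameters considered, i.e. bounded in absolute value by an absolute constant independent of $p,\beta,r,n$.
   Context: $L_p$, $1\le p<\infty$, is the space of $2\pi$-periodic functions $\varphi$ with $\|\varphi\|_p=\big(\int_{-\pi}^{\pi}|\varphi(t)|^p\,dt\big)^{1/p}<\infty$; $L_\infty$ is the space of $2\pi$-periodic measurable essentially bounded functions with $\|\varphi\|_\infty=\operatorname{ess\,sup}_t|\varphi(t)|$. Let $B_1^0=\{\varphi\in L_1:\ \|\varphi\|_1\le 1,\ \int_{-\pi}^{\pi}\varphi(t)\,dt=0\}$. For $r>0$, $\beta\in\mathbb{R}$, the Weyl--Nagy class $W^r_{\beta,1}$ is the set of all $2\pi$-periodic functions $f$ of the form $$f(x)=\frac{a_0}{2}+\frac1\pi\int_{-\pi}^{\pi}\varphi(x-t)B_{r,\beta}(t)\,dt,\quad a_0\in\mathbb{R},\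 \varphi\in B_1^0,\qquad B_{r,\beta}(t)=\sum_{k=1}^\infty k^{-r}\cos\Big(kt-\frac{\beta\pi}{2}\Big).$$ For a set $\mathfrak{N}\subset L_s$, $1\le s\le\infty$, put $$\mathcal{E}_n(\mathfrak{N})_{L_s}=\sup_{f\in\mathfrak{N}}\|f(\cdot)-S_{n-1}(f;\cdot)\|_{s},$$ where $S_{n-1}(f;\cdot)$ is the partial Fourier sum of $f$ of order $n-1$ (harmonics $0,1,\dots,n-1$). $F(a,b;c;z)=1+\sum_{k=1}^\infty\frac{(a)_k(b)_k}{(c)_k}\frac{z^k}{k!}$, with $(x)_k=x(x+1)\cdots(x+k-1)$, is the Gauss hypergeometric function; $F^{1/p}(\cdot)$ denotes its value raised to the power $1/p$. *)

theory Defs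
  imports "HOL-Analysis.Analysis" "HOL-Probability.Essential_Supremum"
begin

definition periodic_2pi :: "(real \<Rightarrow> real) \<Rightarrow> bool" where
  "periodic_2pi \<phi> \<longleftrightarrow> (\<forall>x. \<phi> (x + 2 * pi) = \<phi> x)"

abbreviation per_measure :: "real measure" where
  "per_measure \<equiv> lebesgue_on {-pi..pi}"

(* Norms take values in the extended reals, so that an infinite norm is not confused with 0. *)
definition p_norm :: "ereal \<Rightarrow> (real \<Rightarrow> real) \<Rightarrow> ereal" where
  "p_norm p \<phi> =
    (if p = \<infinity> then esssup per_measure (\<lambda>t. ereal \<bar>\<phi> t\<bar>)
     else (let q = real_of_ereal p;
               I = (\<integral>\<^sup>+ t. ennreal (\<bar>\<phi> t\<bar> powr q) \<partial>per_measure)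
           in if I = \<infinity> then \<infinity> else ereal (enn2real I powr (1 / q))))"

(* Elements are functions, not classes modulo a.e. equality. *)
definition L_space :: "ereal \<Rightarrow> (real \<Rightarrow> real) set" where
  "L_space p = {\<phi>. periodic_2pi \<phi> \<and> \<phi> \<in> borel_measurable per_measure \<and> p_norm p \<phi> < \<infinity>}"

definition unit_ball_mean_zero :: "(real \<Rightarrow> real) set" where
  "unit_ball_mean_zero =
    {\<phi> \<in> L_space 1. p_norm 1 \<phi> \<le> 1 \<and> (LINT t|per_measure. \<phi> t) = 0}"

(* The summation index is shifted: the k-th term carries the harmonic k + 1. *)
definition weyl_nagy_kernel :: "real \<Rightarrow> real \<Rightarrow> real \<Rightarrow> real" where
  "weyl_nagy_kernel r \<beta> t =
    (\<Sum>k. real (Suc k) powr (- r) * cos (real (Suc k) * t - \<beta> * pi / 2))"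

definition weyl_nagy_class :: "real \<Rightarrow> real \<Rightarrow> (real \<Rightarrow> real) set" where
  "weyl_nagy_class r \<beta> =
    {f. periodic_2pi f \<and>
        (\<exists>a0. \<exists>\<phi> \<in> unit_ball_mean_zero. \<forall>x.
           f x = a0 / 2 + 1 / pi * (LINT t|per_measure. \<phi> (x - t) * weyl_nagy_kernel r \<beta> t))}"

definition fourier_cos_coeff :: "(real \<Rightarrow> real) \<Rightarrow> nat \<Rightarrow> real" where
  "fourier_cos_coeff f k = 1 / pi * (LINT t|per_measure. f t * cos (real k * t))"

definition fourier_sin_coeff :: "(real \<Rightarrow> real) \<Rightarrow> nat \<Rightarrow> real" where
  "fourier_sin_coeff f k = 1 / pi * (LINT t|per_measure. f t * sin (real k * t))"

definition fourier_partial_sum :: "nat \<Rightarrow> (real \<Rightarrow> real) \<Rightarrow> real \<Rightarrow> real" where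
  "fourier_partial_sum m f x = fourier_cos_coeff f 0 / 2 +
    (\<Sum>k = 1..m. fourier_cos_coeff f k * cos (real k * x) + fourier_sin_coeff f k * sin (real k * x))"

definition fourier_error :: "nat \<Rightarrow> (real \<Rightarrow> real) set \<Rightarrow> ereal \<Rightarrow> ereal" where
  "fourier_error n N s = (SUP f \<in> N. p_norm s (\<lambda>x. f x - fourier_partial_sum (n - 1) f x))"

definition gauss_hypergeometric :: "real \<Rightarrow> real \<Rightarrow> real \<Rightarrow> real \<Rightarrow> real" where
  "gauss_hypergeometric a b c z =
    1 + (\<Sum>k. pochhammer a (Suc k) * pochhammer b (Suc k) / pochhammer c (Suc k)
               * (z ^ Suc k / fact (Suc k)))"

end

theory Submission
  imports Defs
begin

text \<open>
  The remainder \<open>f - S\<^bsub>n-1\<^esub>(f)\<close> is \<open>1/\<pi>\<close> times the convolution of \<open>\<phi>\<close> with the tail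
  \<open>K(t) = (\<Sum>j. (n+j) powr -r * cos ((n+j) t - \<gamma>))\<close>, \<open>\<gamma> = \<beta>\<pi>/2\<close>. Up to a uniform error
  \<open>O(n powr -r * n/r\<^sup>2)\<close> one may replace \<open>K\<close> by \<open>n powr -r * P \<gamma>\<close>, where
  \<open>P \<gamma> t = (\<Sum>j. q^j cos ((n+j) t - \<gamma>))\<close> and \<open>q = exp (-r/n)\<close>. Translating \<open>P \<gamma>\<close> by \<open>s\<close> amounts to
  changing \<open>\<gamma>\<close> by \<open>n s\<close>, up to a uniform error \<open>|s|/(1-q)\<^sup>2\<close>, which is \<open>O(n/r\<^sup>2)\<close> for \<open>|s| \<le> \<pi>/n\<close>. This has two
  consequences. The translate of \<open>P \<gamma>\<close> by \<open>\<pi>/n\<close> is nearly \<open>-P \<gamma>\<close>, so half the difference of two point masses at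
  distance \<open>\<pi>/n\<close> is a nearly extremal mean-zero \<open>\<phi>\<close>, and the supremum is nearly \<open>1/\<pi>\<close> times the norm of \<open>K\<close>. And the
  norm of \<open>P \<gamma>\<close> nearly does not depend on \<open>\<gamma>\<close>, so it can be computed from the average of its \<open>p\<close>-th power over \<open>\<gamma>\<close>.
  As \<open>P \<gamma> t = A t * cos (\<psi> t - \<gamma>)\<close> with \<open>A t = 1/|1 - q exp(it)|\<close>, that average is a product of the integrals
  of \<open>|cos|\<close> and \<open>A\<close> to the power \<open>p\<close>; the latter is hypergeometric by the binomial series and Parseval's identity.
\<close>

subsection \<open>Integrals of periodic functions\<close>

lemma ident_lebesgue_measurable [measurable]: "(\<lambda>x::real. x) \<in> borel_measurable lebesgue"
  by (simp add: measurable_completion)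

lemma lebesgue_measurable_affine:
  fixes a c :: real
  assumes "c \<noteq> 0"
  shows "(\<lambda>x. a + c * x) \<in> lebesgue \<rightarrow>\<^sub>M lebesgue"
  using lebesgue_affine_measurable[where c = "\<lambda>x::real. c" and t = a] assms by simp

lemma measurable_affine_comp:
  fixes a c :: real
  assumes "f \<in> borel_measurable lebesgue" "c \<noteq> 0"
  shows "(\<lambda>x. f (a + c * x)) \<in> borel_measurable lebesgue"
  using measurable_compose[OF lebesgue_measurable_affine[OF assms(2)] assms(1)] .

lemma period_int:
  fixes h :: "real \<Rightarrow> 'a"
  assumes "\<And>x. h (x + 2 * pi) = h x"
  shows "h (x + 2 * pi * of_int k) = h x"
proof -
  have nat: "h (x + 2 * pi * real n) = h x" for n x
  proof (induction n)
    case (Suc n)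
    have "x + 2 * pi * real (Suc n) = (x + 2 * pi * real n) + 2 * pi" by (simp add: algebra_simps)
    then show ?case using Suc assms by metis
  qed simp
  show ?thesis
  proof (cases "k \<ge> 0")
    case True
    then show ?thesis using nat[of x "nat k"] by simp
  next
    case False
    then show ?thesis using nat[of "x + 2 * pi * of_int k" "nat (- k)"] by simp
  qed
qed

text \<open>Measurability is given on one period only. Countably many translates of
  \<open>{-pi..pi}\<close> cover the line, and on each of them \<open>h\<close> is a translate of
  its restriction to the basic period.\<close>

lemma periodic_measurable:
  fixes h :: "real \<Rightarrow> 'a :: topological_space"
  assumes m: "h \<in> borel_measurable per_measure" and p: "\<And>x. h (x + 2 * pi) = h x"
  shows "h \<in> borel_measurable lebesgue"
proof (rule measurable_piecewise_restrict)
  let ?I = "\<lambda>k::int. {2 * pi * of_int k - pi .. 2 * pi * of_int k + pi}"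
  show "countable (range ?I)" by simp
  show "\<Omega> \<inter> space lebesgue \<in> sets lebesgue" if "\<Omega> \<in> range ?I" for \<Omega> using that by auto
  show "space lebesgue \<subseteq> \<Union> (range ?I)"
  proof
    fix x :: real
    define k where "k = \<lfloor>(x + pi) / (2 * pi)\<rfloor>"
    have "of_int k \<le> (x + pi) / (2 * pi)" "(x + pi) / (2 * pi) < of_int k + 1"
      unfolding k_def by linarith+
    then have "x \<in> ?I k" by (simp add: field_simps)
    then show "x \<in> \<Union> (range ?I)" by blast
  qed
  fix \<Omega> assume "\<Omega> \<in> range ?I"
  then obtain k where k: "\<Omega> = ?I k" by blast
  have 1: "(\<lambda>x. - 2 * pi * of_int k + 1 * x) \<in> lebesgue_on \<Omega> \<rightarrow>\<^sub>M per_measure"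
    by (rule measurable_restrict_space3[OF lebesgue_measurable_affine]) (auto simp: k)
  have "(\<lambda>x. h (- 2 * pi * of_int k + 1 * x)) \<in> borel_measurable (lebesgue_on \<Omega>)"
    using measurable_compose[OF 1 m] .
  moreover have "h (- 2 * pi * of_int k + 1 * x) = h x" for x
    using period_int[of h x "- k", OF p] by (simp add: algebra_simps)
  ultimately show "h \<in> borel_measurable (lebesgue_on \<Omega>)" by simp
qed

text \<open>Half-open periods tile the line without overlap, so translation and additivity can be
  applied to them exactly; the lost endpoint is a null set.\<close>

lemma nn_integral_per:
  assumes "h \<in> borel_measurable lebesgue"
  shows "(\<integral>\<^sup>+t. h t \<partial>per_measure) = (\<integral>\<^sup>+t. h t * indicator {-pi..<pi} t \<partial>lebesgue)"
proof -
  have "(\<integral>\<^sup>+t. h t \<partial>per_measure) = (\<integral>\<^sup>+t. h t * indicator {-pi..pi} t \<partial>lebesgue)"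
    by (subst nn_integral_restrict_space) auto
  also have "\<dots> = (\<integral>\<^sup>+t. h t * indicator {-pi..<pi} t \<partial>lebesgue)"
  proof (rule nn_integral_cong_AE)
    have "AE t in lebesgue. t \<noteq> pi"
      by (rule AE_I[where N = "{pi}"]) (auto simp: emeasure_completion)
    then show "AE t in lebesgue. h t * indicator {-pi..pi} t = h t * indicator {-pi..<pi} t"
      by eventually_elim (auto simp: indicator_def)
  qed
  finally show ?thesis .
qed

lemma nn_integral_shift_lebesgue:
  fixes f :: "real \<Rightarrow> ennreal"
  assumes "f \<in> borel_measurable lebesgue"
  shows "(\<integral>\<^sup>+t. f (a + t) \<partial>lebesgue) = (\<integral>\<^sup>+t. f t \<partial>lebesgue)"
  using nn_integral_real_affine_lebesgue[OF assms, of 1 a] by simp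

lemma nn_integral_period_shift:
  fixes h :: "real \<Rightarrow> ennreal"
  assumes m[measurable]: "h \<in> borel_measurable lebesgue" and p: "\<And>x. h (x + 2 * pi) = h x"
  shows "(\<integral>\<^sup>+t. h (a + t) \<partial>per_measure) = (\<integral>\<^sup>+t. h t \<partial>per_measure)"
proof -
  let ?N = "\<lambda>A. \<integral>\<^sup>+t. h t * indicator A t \<partial>lebesgue"
  define b where "b = a - pi"
  have 0: "(\<integral>\<^sup>+t. h (a + t) \<partial>per_measure) = ?N {b..<b + 2 * pi}"
  proof -
    have "(\<integral>\<^sup>+t. h (a + t) \<partial>per_measure) = (\<integral>\<^sup>+t. h (a + t) * indicator {-pi..<pi} t \<partial>lebesgue)"
      using measurable_affine_comp[OF m, of 1 a] by (intro nn_integral_per) simp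
    also have "\<dots> = (\<integral>\<^sup>+t. h (a + t) * indicator {b..<b + 2 * pi} (a + t) \<partial>lebesgue)"
      by (intro nn_integral_cong) (auto simp: b_def indicator_def)
    also have "\<dots> = ?N {b..<b + 2 * pi}"
      by (rule nn_integral_shift_lebesgue[where f = "\<lambda>t. h t * indicator {b..<b + 2 * pi} t"]) measurable
    finally show ?thesis .
  qed
  have sh: "?N {x + 2 * pi * of_int k..<y + 2 * pi * of_int k} = ?N {x..<y}" for x y k
  proof -
    have "?N {x + 2 * pi * of_int k..<y + 2 * pi * of_int k} =
        (\<integral>\<^sup>+t. h (2 * pi * of_int k + t) *
          indicator {x + 2 * pi * of_int k..<y + 2 * pi * of_int k} (2 * pi * of_int k + t) \<partial>lebesgue)"
      by (rule nn_integral_shift_lebesgue[symmetric]) measurable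
    also have "\<dots> = ?N {x..<y}"
      using period_int[of h, OF p] by (intro nn_integral_cong) (auto simp: indicator_def add.commute)
    finally show ?thesis .
  qed
  have split: "?N {x..<z} = ?N {x..<y} + ?N {y..<z}" if "x \<le> y" "y \<le> z" for x y z
  proof -
    have "?N {x..<z} = (\<integral>\<^sup>+t. h t * indicator {x..<y} t + h t * indicator {y..<z} t \<partial>lebesgue)"
      using that by (intro nn_integral_cong) (auto simp: indicator_def)
    also have "\<dots> = ?N {x..<y} + ?N {y..<z}" by (intro nn_integral_add) measurable
    finally show ?thesis .
  qed
  \<comment> \<open>\<open>c\<close> is a point of the window congruent to \<open>- pi\<close>
    modulo the period. The piece left of \<open>c\<close> is moved one period to the right, and the
    full period starting at \<open>c\<close> is an integer translate of the basic one.\<close>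
  define k where "k = \<lceil>(b + pi) / (2 * pi)\<rceil>"
  define c where "c = - pi + 2 * pi * of_int k"
  have "of_int k \<ge> (b + pi) / (2 * pi)" "(b + pi) / (2 * pi) > of_int k - 1"
    unfolding k_def by linarith+
  then have c: "b \<le> c" "c \<le> b + 2 * pi" by (simp_all add: c_def field_simps)
  have "?N {b..<b + 2 * pi} = ?N {b..<c} + ?N {c..<b + 2 * pi}" using c by (rule split)
  also have "?N {b..<c} = ?N {b + 2 * pi..<c + 2 * pi}" using sh[of b 1 c] by simp
  also have "?N {b + 2 * pi..<c + 2 * pi} + ?N {c..<b + 2 * pi} = ?N {c..<c + 2 * pi}"
    using split[of c "b + 2 * pi" "c + 2 * pi"] c by (simp add: add.commute)
  also have "\<dots> = ?N {-pi..<pi}" using sh[of "-pi" k pi] by (simp add: c_def)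
  finally show ?thesis unfolding 0 nn_integral_per[OF m] .
qed

lemma nn_integral_period_reflect:
  fixes h :: "real \<Rightarrow> ennreal"
  assumes m[measurable]: "h \<in> borel_measurable lebesgue" and p: "\<And>x. h (x + 2 * pi) = h x"
  shows "(\<integral>\<^sup>+t. h (a - t) \<partial>per_measure) = (\<integral>\<^sup>+t. h t \<partial>per_measure)"
proof -
  have m': "(\<lambda>t. h (a - t)) \<in> borel_measurable lebesgue"
    using measurable_affine_comp[OF m, of "-1" a] by simp
  have "(\<integral>\<^sup>+t. h (a - t) \<partial>per_measure) = (\<integral>\<^sup>+t. h (a - t) * indicator {-pi..pi} t \<partial>lebesgue)"
    by (subst nn_integral_restrict_space) auto
  also have "\<dots> = (\<integral>\<^sup>+t. h (a + t) * indicator {-pi..pi} t \<partial>lebesgue)"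
  proof (subst nn_integral_real_affine_lebesgue[where c = "-1" and t = 0])
    show "(\<lambda>t. h (a - t) * indicator {- pi..pi} t) \<in> borel_measurable lebesgue"
      using m' by measurable
  qed (auto simp: indicator_def intro!: nn_integral_cong)
  also have "\<dots> = (\<integral>\<^sup>+t. h (a + t) \<partial>per_measure)"
    by (subst nn_integral_restrict_space) auto
  finally show ?thesis using nn_integral_period_shift[OF m p] by simp
qed

lemma lebesgue_imp_per_measurable:
  "f \<in> borel_measurable lebesgue \<Longrightarrow> f \<in> borel_measurable per_measure"
  by (simp add: measurable_restrict_space1)

lemma integral_period_reflect:
  fixes f :: "real \<Rightarrow> real"
  assumes m[measurable]: "f \<in> borel_measurable lebesgue" and p: "\<And>x. f (x + 2 * pi) = f x"
    and i: "integrable per_measure f"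
  shows "integrable per_measure (\<lambda>t. f (a - t))"
    and "(LINT t|per_measure. f (a - t)) = (LINT t|per_measure. f t)"
proof -
  have m': "(\<lambda>t. f (a - t)) \<in> borel_measurable per_measure"
    using measurable_affine_comp[OF m, of "-1" a] by (intro lebesgue_imp_per_measurable) simp
  \<comment> \<open>The free test function \<open>g\<close> serves three times: as the norm, for
    integrability, and as the positive and the negative part, for the value.\<close>
  have eq: "(\<integral>\<^sup>+t. g (f (a - t)) \<partial>per_measure) = (\<integral>\<^sup>+t. g (f t) \<partial>per_measure)"
    if [measurable]: "g \<in> borel_measurable borel" for g :: "real \<Rightarrow> ennreal"
    by (rule nn_integral_period_reflect[where h = "\<lambda>t. g (f t)"]) (measurable, simp add: p)
  show *: "integrable per_measure (\<lambda>t. f (a - t))"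
    unfolding integrable_iff_bounded
    using i m' eq[of "\<lambda>x. ennreal (norm x)"] by (auto simp: integrable_iff_bounded)
  show "(LINT t|per_measure. f (a - t)) = (LINT t|per_measure. f t)"
    unfolding real_lebesgue_integral_def[OF *] real_lebesgue_integral_def[OF i]
    using eq[of "\<lambda>x. ennreal x"] eq[of "\<lambda>x. ennreal (- x)"] by simp
qed

lemma integral_period_shift:
  fixes f :: "real \<Rightarrow> real"
  assumes m[measurable]: "f \<in> borel_measurable lebesgue" and p: "\<And>x. f (x + 2 * pi) = f x"
    and i: "integrable per_measure f"
  shows "integrable per_measure (\<lambda>t. f (t - a))"
    and "(LINT t|per_measure. f (t - a)) = (LINT t|per_measure. f t)"
proof -
  \<comment> \<open>A translation is the composite of two reflections.\<close>
  define g where "g = (\<lambda>t. f (0 - t))"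
  have g: "g \<in> borel_measurable lebesgue"
    using measurable_affine_comp[OF m, of "-1" 0] by (simp add: g_def)
  have pg: "g (x + 2 * pi) = g x" for x
    using p[of "- x - 2 * pi"] by (simp add: g_def)
  have gi: "integrable per_measure g" unfolding g_def by (rule integral_period_reflect[OF m p i])
  show "integrable per_measure (\<lambda>t. f (t - a))"
    using integral_period_reflect(1)[OF g pg gi, of a] by (simp add: g_def)
  show "(LINT t|per_measure. f (t - a)) = (LINT t|per_measure. f t)"
    using integral_period_reflect(2)[OF g pg gi, of a] integral_period_reflect(2)[OF m p i, of 0]
    by (simp add: g_def)
qed

subsection \<open>The norms\<close>

text \<open>Moves norm comparisons to nonnegative integrals, where an infinite value needs no
  separate treatment.\<close>

lemma p_norm_finite_le_iff:
  assumes "p > 0" "c \<ge> 0"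
  shows "p_norm (ereal p) f \<le> ereal c \<longleftrightarrow>
    (\<integral>\<^sup>+ t. ennreal (\<bar>f t\<bar> powr p) \<partial>per_measure) \<le> ennreal (c powr p)"
proof -
  define I where "I = (\<integral>\<^sup>+ t. ennreal (\<bar>f t\<bar> powr p) \<partial>per_measure)"
  have *: "p_norm (ereal p) f = (if I = \<infinity> then \<infinity> else ereal (enn2real I powr (1 / p)))"
    by (simp add: p_norm_def I_def Let_def)
  show ?thesis
  proof (cases "I = \<infinity>")
    case True
    then show ?thesis using * by (simp add: I_def top_unique)
  next
    case False
    then obtain i where i: "I = ennreal i" "i \<ge> 0" by (cases I) auto
    have "i powr (1 / p) \<le> c \<longleftrightarrow> i \<le> c powr p"
    proof
      assume "i powr (1 / p) \<le> c"
      then have "(i powr (1 / p)) powr p \<le> c powr p" using assms by (intro powr_mono2) auto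
      then show "i \<le> c powr p" using assms i by (simp add: powr_powr)
    next
      assume "i \<le> c powr p"
      then have "i powr (1 / p) \<le> (c powr p) powr (1 / p)" using assms i by (intro powr_mono2) auto
      then show "i powr (1 / p) \<le> c" using assms by (simp add: powr_powr)
    qed
    then show ?thesis using * False i unfolding I_def[symmetric] by simp
  qed
qed

lemma p_norm_finite_eq:
  assumes "p > 0" "i \<ge> 0"
    and "(\<integral>\<^sup>+ t. ennreal (\<bar>f t\<bar> powr p) \<partial>per_measure) = ennreal i"
  shows "p_norm (ereal p) f = ereal (i powr (1 / p))"
  using assms by (simp add: p_norm_def)

text \<open>A convex function lies above its tangent at \<open>v\<close>. The Minkowski, Jensen and
  Bernoulli inequalities below are all read off from this.\<close>

lemma powr_tangent:
  fixes u v p :: real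
  assumes "u \<ge> 0" "v > 0" "p \<ge> 1"
  shows "u powr p \<ge> v powr p + p * v powr (p - 1) * (u - v)"
proof (cases "u = 0")
  \<comment> \<open>The convexity argument runs on the open half-line, so its endpoint is checked by
    hand.\<close>
  case True
  have "v powr p = v * v powr (p - 1)" using assms by (simp add: powr_mult_base)
  then have "v powr p + p * v powr (p - 1) * (u - v) = (1 - p) * (v * v powr (p - 1))"
    using True by (simp add: algebra_simps)
  also have "\<dots> \<le> 0" using assms by (intro mult_nonpos_nonneg) auto
  finally show ?thesis using True by simp
next
  case False
  have "u powr p - v powr p \<ge> (p * v powr (p - 1)) * (u - v)"
  proof (rule convex_on_imp_above_tangent[where A = "{0<..}"])
    show "convex_on {0<..} (\<lambda>x. x powr p)" using powr_convex assms by blast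
    show "((\<lambda>x. x powr p) has_real_derivative p * v powr (p - 1)) (at v within {0<..})"
      using assms by (auto intro!: derivative_eq_intros simp: powr_diff)
  qed (use assms False in \<open>auto simp: interior_open\<close>)
  then show ?thesis by linarith
qed

text \<open>Convexity at the weights \<open>l\<close> and \<open>1 - l\<close>; an optimal \<open>l\<close> turns it into Minkowski's inequality.\<close>

lemma powr_add_le:
  fixes u d p l :: real
  assumes "u \<ge> 0" "d \<ge> 0" "p \<ge> 1" "0 < l" "l < 1"
  shows "(u + d) powr p \<le> l powr (1 - p) * u powr p + (1 - l) powr (1 - p) * d powr p"
proof (cases "u + d = 0")
  case True
  then have "u = 0" "d = 0" using assms by auto
  then show ?thesis by simp
next
  case False
  define v where "v = u + d"
  have v: "v > 0" using False assms by (simp add: v_def)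
  have 1: "(u / l) powr p \<ge> v powr p + p * v powr (p - 1) * (u / l - v)"
    using assms v by (intro powr_tangent) auto
  have 2: "(d / (1 - l)) powr p \<ge> v powr p + p * v powr (p - 1) * (d / (1 - l) - v)"
    using assms v by (intro powr_tangent) auto
  have "l * (u / l) powr p + (1 - l) * (d / (1 - l)) powr p \<ge>
      l * (v powr p + p * v powr (p - 1) * (u / l - v))
      + (1 - l) * (v powr p + p * v powr (p - 1) * (d / (1 - l) - v))"
    using 1 2 assms by (intro add_mono mult_left_mono) auto
  also have "l * (v powr p + p * v powr (p - 1) * (u / l - v))
      + (1 - l) * (v powr p + p * v powr (p - 1) * (d / (1 - l) - v)) =
      v powr p + p * v powr (p - 1) * (l * (u / l) + (1 - l) * (d / (1 - l)) - v)"
    by (simp add: algebra_simps)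
  also have "l * (u / l) + (1 - l) * (d / (1 - l)) - v = 0" using assms by (simp add: v_def)
  finally have 3: "v powr p \<le> l * (u / l) powr p + (1 - l) * (d / (1 - l)) powr p" by simp
  have 4: "l * (u / l) powr p = l powr (1 - p) * u powr p" if "l > 0" "u \<ge> 0" for l u :: real
    using that by (simp add: powr_divide powr_diff)
  show ?thesis using 3 4[of l u] 4[of "1 - l" d] assms by (simp add: v_def)
qed

lemma emeasure_per_measure: "emeasure per_measure (space per_measure) = ennreal (2 * pi)"
  by (simp add: emeasure_restrict_space)

text \<open>The constant \<open>d\<close> has norm \<open>d * (2 * pi) powr (1 / p)\<close>, which
  is at most \<open>2 * pi * d\<close> for every exponent. This bound, free of \<open>p\<close>,
  keeps the final constant independent of the exponent.\<close>

lemma p_norm_le_add: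
  assumes s: "s \<ge> 1" and f[measurable]: "f \<in> borel_measurable per_measure"
    and g[measurable]: "g \<in> borel_measurable per_measure"
    and d: "d \<ge> 0" and fg: "\<And>t. t \<in> {-pi..pi} \<Longrightarrow> \<bar>f t\<bar> \<le> \<bar>g t\<bar> + d"
  shows "p_norm s f \<le> p_norm s g + ereal (2 * pi * d)"
proof (cases "s = \<infinity>")
  case True
  have "esssup per_measure (\<lambda>t. ereal \<bar>f t\<bar>) \<le> esssup per_measure (\<lambda>t. ereal \<bar>g t\<bar>) + ereal d"
  proof (rule esssup_I)
    show "AE t in per_measure. ereal \<bar>f t\<bar> \<le> esssup per_measure (\<lambda>t. ereal \<bar>g t\<bar>) + ereal d"
      using esssup_AE[of "\<lambda>t. ereal \<bar>g t\<bar>" per_measure] AE_space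
    proof eventually_elim
      case (elim t)
      have "ereal \<bar>f t\<bar> \<le> ereal \<bar>g t\<bar> + ereal d" using fg[of t] elim by simp
      also have "\<dots> \<le> esssup per_measure (\<lambda>t. ereal \<bar>g t\<bar>) + ereal d"
        using elim by (intro add_right_mono)
      finally show ?case .
    qed
  qed measurable
  also have "\<dots> \<le> esssup per_measure (\<lambda>t. ereal \<bar>g t\<bar>) + ereal (2 * pi * d)"
  proof (intro add_left_mono)
    have "1 * d \<le> 2 * pi * d" using d pi_ge_two by (intro mult_right_mono) auto
    then show "ereal d \<le> ereal (2 * pi * d)" by simp
  qed
  finally show ?thesis using True by (simp add: p_norm_def)
next
  case False
  then obtain p where p: "s = ereal p" "p \<ge> 1" using s by (cases s) (auto simp: one_ereal_def)
  show ?thesis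
  proof (cases "p_norm s g = \<infinity>")
    case True
    then show ?thesis by simp
  next
    case False
    then obtain a where a: "p_norm s g = ereal a" "a \<ge> 0"
      by (auto simp: p p_norm_def Let_def split: if_splits)
    have Ig: "(\<integral>\<^sup>+ t. ennreal (\<bar>g t\<bar> powr p) \<partial>per_measure) \<le> ennreal (a powr p)"
      using p_norm_finite_le_iff[of p a g] a p by simp
    have "p_norm s f \<le> ereal (a + 2 * pi * d) + ereal e" if e: "e > 0" for e
    proof -
      \<comment> \<open>The surplus \<open>e\<close> makes both numbers strictly positive, so that
        the weight \<open>l\<close> lies strictly between 0 and 1; it is sent to 0 at the
        end.\<close>
      define a' k where "a' = a + e / 2" and "k = 2 * pi * d + e / 2"
      have pos: "a' > 0" "k > 0" using a d e by (auto simp: a'_def k_def add_nonneg_pos)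
      \<comment> \<open>The optimal weight: with it the two convexity terms add up to exactly
        \<open>(a' + k) powr p\<close>.\<close>
      define l where "l = a' / (a' + k)"
      have l: "0 < l" "l < 1" "1 - l = k / (a' + k)" using pos by (auto simp: l_def field_simps)
      have "(\<integral>\<^sup>+ t. ennreal (\<bar>f t\<bar> powr p) \<partial>per_measure) \<le>
        (\<integral>\<^sup>+ t. ennreal (l powr (1 - p)) * ennreal (\<bar>g t\<bar> powr p)
            + ennreal ((1 - l) powr (1 - p) * d powr p) \<partial>per_measure)"
      proof (rule nn_integral_mono)
        fix t assume "t \<in> space per_measure"
        then have "\<bar>f t\<bar> powr p \<le> (\<bar>g t\<bar> + d) powr p" using fg[of t] p by (intro powr_mono2) auto
        also have "\<dots> \<le> l powr (1 - p) * \<bar>g t\<bar> powr p + (1 - l) powr (1 - p) * d powr p"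
          using d p l by (intro powr_add_le) auto
        finally show "ennreal (\<bar>f t\<bar> powr p) \<le> ennreal (l powr (1 - p)) * ennreal (\<bar>g t\<bar> powr p)
            + ennreal ((1 - l) powr (1 - p) * d powr p)"
          by (simp add: ennreal_mult'[symmetric] ennreal_plus[symmetric] del: ennreal_plus)
      qed
      also have "\<dots> = ennreal (l powr (1 - p)) * (\<integral>\<^sup>+ t. ennreal (\<bar>g t\<bar> powr p) \<partial>per_measure)
          + ennreal ((1 - l) powr (1 - p) * d powr p) * ennreal (2 * pi)"
        by (subst nn_integral_add) (auto simp: nn_integral_cmult emeasure_restrict_space)
      also have "\<dots> \<le> ennreal (l powr (1 - p)) * ennreal (a' powr p)
          + ennreal ((1 - l) powr (1 - p)) * ennreal (k powr p)"
      proof (intro add_mono mult_left_mono)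
        have "a powr p \<le> a' powr p" using a e p by (intro powr_mono2) (auto simp: a'_def)
        then show "(\<integral>\<^sup>+ t. ennreal (\<bar>g t\<bar> powr p) \<partial>per_measure) \<le> ennreal (a' powr p)"
          using Ig by (meson ennreal_leI order_trans)
        have "d powr p * (2 * pi) \<le> d powr p * (2 * pi) powr p"
          using p pi_ge_two powr_mono[of 1 p "2 * pi"] by (intro mult_left_mono) auto
        also have "\<dots> = (2 * pi * d) powr p" using d by (simp add: powr_mult)
        also have "\<dots> \<le> k powr p" using d e p by (intro powr_mono2) (auto simp: k_def)
        finally have "d powr p * (2 * pi) \<le> k powr p" .
        then have "(1 - l) powr (1 - p) * (d powr p * (2 * pi)) \<le> (1 - l) powr (1 - p) * k powr p"
          by (intro mult_left_mono) auto
        then show "ennreal ((1 - l) powr (1 - p) * d powr p) * ennreal (2 * pi)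
            \<le> ennreal ((1 - l) powr (1 - p)) * ennreal (k powr p)"
          by (simp add: ennreal_mult'[symmetric] mult.assoc)
      qed auto
      also have "\<dots> = ennreal ((a' + k) powr p)"
      proof -
        have 4: "(x / y) powr (1 - p) * x powr p = x * y powr (p - 1)" if "x > 0" "y > 0" for x y :: real
          using that by (simp add: powr_divide powr_diff field_simps)
        have "l powr (1 - p) * a' powr p + (1 - l) powr (1 - p) * k powr p
            = (a' + k) * (a' + k) powr (p - 1)"
          unfolding l(3) unfolding l_def using pos 4[of a' "a' + k"] 4[of k "a' + k"]
          by (simp add: algebra_simps)
        also have "\<dots> = (a' + k) powr p" using pos by (simp add: powr_mult_base)
        finally show ?thesis
          by (simp add: ennreal_mult'[symmetric] ennreal_plus[symmetric] del: ennreal_plus)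
      qed
      finally have "p_norm s f \<le> ereal (a' + k)"
        using p_norm_finite_le_iff[of p "a' + k" f] pos p by simp
      also have "a' + k = a + 2 * pi * d + e" by (simp add: a'_def k_def)
      finally show ?thesis by simp
    qed
    then show ?thesis using a ereal_le_epsilon2[of "p_norm s f" "ereal (a + 2 * pi * d)"] by auto
  qed
qed

lemma p_norm_cmult:
  assumes c: "c > 0" and s: "s \<ge> 1" and f[measurable]: "f \<in> borel_measurable per_measure"
  shows "p_norm s (\<lambda>t. c * f t) = ereal c * p_norm s f"
proof (cases "s = \<infinity>")
  case True
  show ?thesis using esssup_cmult[OF c, of per_measure "\<lambda>t. ereal \<bar>f t\<bar>"] True c
    by (simp add: p_norm_def abs_mult)
next
  case False
  then obtain p where p: "s = ereal p" "p \<ge> 1" using s by (cases s) (auto simp: one_ereal_def)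
  define I where "I = (\<integral>\<^sup>+ t. ennreal (\<bar>f t\<bar> powr p) \<partial>per_measure)"
  have "(\<integral>\<^sup>+ t. ennreal (\<bar>c * f t\<bar> powr p) \<partial>per_measure) =
      (\<integral>\<^sup>+ t. ennreal (c powr p) * ennreal (\<bar>f t\<bar> powr p) \<partial>per_measure)"
    using c by (intro nn_integral_cong) (simp add: abs_mult powr_mult ennreal_mult'[symmetric])
  also have "\<dots> = ennreal (c powr p) * I" unfolding I_def by (rule nn_integral_cmult) measurable
  finally have *: "(\<integral>\<^sup>+ t. ennreal (\<bar>c * f t\<bar> powr p) \<partial>per_measure) = ennreal (c powr p) * I" .
  show ?thesis
  proof (cases "I = \<infinity>")
    case True
    then show ?thesis using * c unfolding p_norm_def p Let_def I_def[symmetric]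
      by (simp add: I_def ennreal_mult_top)
  next
    case False
    then obtain i where i: "I = ennreal i" "i \<ge> 0" by (cases I) auto
    have "p_norm s f = ereal (i powr (1 / p))"
      unfolding p using i p by (intro p_norm_finite_eq) (auto simp: I_def)
    moreover have "p_norm s (\<lambda>t. c * f t) = ereal ((c powr p * i) powr (1 / p))"
      unfolding p using i p * by (intro p_norm_finite_eq) (auto simp: ennreal_mult')
    moreover have "(c powr p * i) powr (1 / p) = c * i powr (1 / p)"
      using c i p by (simp add: powr_mult powr_powr)
    ultimately show ?thesis by simp
  qed
qed

subsection \<open>Trigonometric series\<close>

text \<open>Counting from the lowest harmonic \<open>m\<close> lets one notion cover the Weyl-Nagy
  kernel (\<open>m = 1\<close>), its tail (\<open>m = n\<close>) and the geometric kernel; the phase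
  \<open>pi / 2\<close> with \<open>m = 0\<close> gives sine series.\<close>

definition cos_series :: "(nat \<Rightarrow> real) \<Rightarrow> nat \<Rightarrow> real \<Rightarrow> real \<Rightarrow> real" where
  "cos_series c m g t = (\<Sum>j. c j * cos (real (m + j) * t - g))"

lemma cos_series_summable:
  assumes "summable (\<lambda>j. \<bar>c j\<bar>)"
  shows "summable (\<lambda>j. \<bar>c j * cos (real (m + j) * t - g)\<bar>)"
    and "summable (\<lambda>j. c j * cos (real (m + j) * t - g))"
proof -
  show 1: "summable (\<lambda>j. \<bar>c j * cos (real (m + j) * t - g)\<bar>)"
    by (rule summable_comparison_test'[OF assms, of 0]) (auto simp: abs_mult intro: mult_left_le)
  show "summable (\<lambda>j. c j * cos (real (m + j) * t - g))"
    using 1 by (rule summable_rabs_cancel)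
qed

lemma cos_series_bound:
  assumes "summable (\<lambda>j. \<bar>c j\<bar>)"
  shows "\<bar>cos_series c m g t\<bar> \<le> (\<Sum>j. \<bar>c j\<bar>)"
proof -
  have "\<bar>cos_series c m g t\<bar> \<le> (\<Sum>j. \<bar>c j * cos (real (m + j) * t - g)\<bar>)"
    unfolding cos_series_def by (rule summable_rabs[OF cos_series_summable(1)[OF assms]])
  also have "\<dots> \<le> (\<Sum>j. \<bar>c j\<bar>)"
    by (intro suminf_le cos_series_summable assms) (auto simp: abs_mult intro: mult_left_le)
  finally show ?thesis .
qed

lemma cos_series_diff_bound:
  assumes "summable (\<lambda>j. \<bar>c j\<bar>)" "summable (\<lambda>j. \<bar>d j\<bar>)" "summable (\<lambda>j. \<bar>c j - d j\<bar>)"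
  shows "\<bar>cos_series c m g t - cos_series d m g t\<bar> \<le> (\<Sum>j. \<bar>c j - d j\<bar>)"
proof -
  have "cos_series c m g t - cos_series d m g t = cos_series (\<lambda>j. c j - d j) m g t"
    unfolding cos_series_def
    by (subst suminf_diff[OF cos_series_summable(2)[OF assms(1)] cos_series_summable(2)[OF assms(2)]])
       (simp add: algebra_simps)
  then show ?thesis using cos_series_bound[OF assms(3), of m g t] by simp
qed

lemma cos_series_continuous:
  assumes "summable (\<lambda>j. \<bar>c j\<bar>)"
  shows "continuous_on A (cos_series c m g)"
proof -
  have "uniform_limit A (\<lambda>n t. \<Sum>j<n. c j * cos (real (m + j) * t - g)) (cos_series c m g) sequentially"
    unfolding cos_series_def
    by (rule Weierstrass_m_test[OF _ assms]) (auto simp: abs_mult intro: mult_left_le)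
  moreover have "\<forall>\<^sub>F n in sequentially. continuous_on A (\<lambda>t. \<Sum>j<n. c j * cos (real (m + j) * t - g))"
    by (intro always_eventually allI continuous_intros)
  ultimately show ?thesis by (intro uniform_limit_theorem[OF _ _ trivial_limit_sequentially])
qed

lemma cos_series_periodic: "cos_series c m g (t + 2 * pi) = cos_series c m g t"
proof -
  have "cos (real k * (t + 2 * pi) - g) = cos (real k * t - g)" for k
  proof -
    have "real k * (t + 2 * pi) - g = (real k * t - g) + 2 * pi * of_int (int k)"
      by (simp add: algebra_simps)
    then show ?thesis using period_int[of cos, OF cos_periodic] by metis
  qed
  then show ?thesis unfolding cos_series_def by (simp only:)
qed

lemma continuous_imp_lebesgue_measurable:
  "continuous_on UNIV f \<Longrightarrow> (f :: real \<Rightarrow> 'a :: topological_space) \<in> borel_measurable lebesgue"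
  using borel_measurable_continuous_onI[of f] by (simp add: measurable_completion)

text \<open>The bounds \<open>B k\<close> are uniform in \<open>t\<close>, so the series converges
  absolutely against any integrable \<open>w\<close>. In the applications \<open>w\<close> is a
  trigonometric function, the function \<open>\<phi>\<close>, or the series itself.\<close>

lemma integral_termwise:
  fixes u :: "nat \<Rightarrow> real \<Rightarrow> real"
  assumes w: "integrable M w" and u[measurable]: "\<And>k. u k \<in> borel_measurable M"
    and b: "\<And>k t. \<bar>u k t\<bar> \<le> B k" and B: "summable B"
  shows "(\<lambda>k. LINT t|M. u k t * w t) sums (LINT t|M. (\<Sum>k. u k t) * w t)"
proof -
  have [measurable]: "w \<in> borel_measurable M" using w by simp
  have B0: "B k \<ge> 0" for k using b[of k 0] by linarith
  have su: "summable (\<lambda>k. u k t)" for t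
    by (rule summable_comparison_test'[OF B, of 0]) (use b in auto)
  have i: "integrable M (\<lambda>t. u k t * w t)" for k
    by (rule Bochner_Integration.integrable_bound[where f = "\<lambda>t. B k * w t"])
       (use w b B0 in \<open>auto simp: abs_mult intro!: mult_right_mono\<close>)
  have "(\<lambda>k. LINT t|M. u k t * w t) sums (LINT t|M. (\<Sum>k. u k t * w t))"
  proof (rule sums_integral[OF i])
    show "AE t in M. summable (\<lambda>k. norm (u k t * w t))"
    proof (rule AE_I2)
      fix t
      show "summable (\<lambda>k. norm (u k t * w t))"
        by (rule summable_comparison_test'[OF summable_mult2[OF B, of "\<bar>w t\<bar>"], of 0])
           (use b in \<open>auto simp: abs_mult intro!: mult_right_mono\<close>)
    qed
    show "summable (\<lambda>k. LINT t|M. norm (u k t * w t))"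
    proof (rule summable_comparison_test'[OF summable_mult2[OF B, of "LINT t|M. \<bar>w t\<bar>"], of 0])
      fix k
      have "(LINT t|M. norm (u k t * w t)) \<le> (LINT t|M. B k * \<bar>w t\<bar>)"
        using w integrable_abs[OF i[of k]] b by (intro integral_mono) (auto simp: abs_mult intro!: mult_right_mono)
      then show "norm (LINT t|M. norm (u k t * w t)) \<le> B k * (LINT t|M. \<bar>w t\<bar>)" by simp
    qed
  qed
  moreover have "(\<Sum>k. u k t * w t) = (\<Sum>k. u k t) * w t" for t
    by (rule suminf_mult2[OF su, symmetric])
  ultimately show ?thesis by simp
qed

section \<open>Orthogonality and the coefficients of absolutely convergent trigonometric
  series\<close>

lemma integrable_per_continuous:
  fixes f :: "real \<Rightarrow> real"
  assumes "continuous_on UNIV f"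
  shows "integrable per_measure f"
  using continuous_on_subset[OF assms, of "{-pi..pi}"] continuous_imp_integrable_real by blast

lemma integral_per_derivative:
  fixes F f :: "real \<Rightarrow> real"
  assumes "continuous_on UNIV f" "\<And>t. (F has_real_derivative f t) (at t)"
  shows "(LINT t|per_measure. f t) = F pi - F (- pi)"
proof -
  have "(f has_integral (F pi - F (- pi))) {-pi..pi}"
    using assms(2) by (intro fundamental_theorem_of_calculus)
      (auto intro: has_field_derivative_at_within simp flip: has_real_derivative_iff_has_vector_derivative)
  moreover have "(LINT t|per_measure. f t) = integral {-pi..pi} f"
    by (rule lebesgue_integral_eq_integral[OF integrable_per_continuous[OF assms(1)]]) auto
  ultimately show ?thesis by (simp add: integral_unique)
qed

lemma integral_cos_int: "(LINT t|per_measure. cos (of_int m * t)) = (if m = 0 then 2 * pi else 0)"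
proof (cases "m = 0")
  case True
  then show ?thesis by (simp add: measure_restrict_space)
next
  case False
  have "(LINT t|per_measure. cos (of_int m * t)) = sin (of_int m * pi) / of_int m - sin (of_int m * (- pi)) / of_int m"
    by (rule integral_per_derivative)
       (use False in \<open>auto intro!: derivative_eq_intros continuous_intros\<close>)
  then show ?thesis using False sin_int_times_real[of m pi] by (simp add: mult.commute)
qed

lemma integral_sin_int: "(LINT t|per_measure. sin (of_int m * t)) = 0"
proof (cases "m = 0")
  case False
  have "(LINT t|per_measure. sin (of_int m * t)) = - cos (of_int m * pi) / of_int m - (- cos (of_int m * (- pi)) / of_int m)"
    by (rule integral_per_derivative)
       (use False in \<open>auto intro!: derivative_eq_intros continuous_intros\<close>)
  then show ?thesis by simp
qed simp

lemma trig_orthogonal: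
  fixes j k :: nat
  shows "(LINT t|per_measure. cos (real j * t) * cos (real k * t)) =
      (if j = k then if k = 0 then 2 * pi else pi else 0)"
    and "(LINT t|per_measure. sin (real j * t) * sin (real k * t)) =
      (if j = k \<and> k \<noteq> 0 then pi else 0)"
    and "(LINT t|per_measure. sin (real j * t) * cos (real k * t)) = 0"
proof -
  \<comment> \<open>The difference of the frequencies may be negative, hence the passage to
    integers.\<close>
  let ?p = "int j + int k" and ?m = "int j - int k"
  have i: "integrable per_measure (\<lambda>t. cos (of_int m * t))" "integrable per_measure (\<lambda>t. sin (of_int m * t))" for m
    by (intro integrable_per_continuous continuous_intros)+
  have "cos (real j * t) * cos (real k * t) = 1/2 * cos (of_int ?m * t) + 1/2 * cos (of_int ?p * t)" for t
    by (simp add: algebra_simps cos_add cos_diff)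
  then show "(LINT t|per_measure. cos (real j * t) * cos (real k * t)) =
      (if j = k then if k = 0 then 2 * pi else pi else 0)"
    using i[of ?p] i[of ?m] integral_cos_int[of ?p] integral_cos_int[of ?m] by auto
  have "sin (real j * t) * sin (real k * t) = 1/2 * cos (of_int ?m * t) - 1/2 * cos (of_int ?p * t)" for t
    by (simp add: algebra_simps cos_add cos_diff)
  then show "(LINT t|per_measure. sin (real j * t) * sin (real k * t)) =
      (if j = k \<and> k \<noteq> 0 then pi else 0)"
    using i[of ?p] i[of ?m] integral_cos_int[of ?p] integral_cos_int[of ?m] by auto
  have "sin (real j * t) * cos (real k * t) = 1/2 * sin (of_int ?p * t) + 1/2 * sin (of_int ?m * t)" for t
    by (simp add: algebra_simps sin_add sin_diff)
  then show "(LINT t|per_measure. sin (real j * t) * cos (real k * t)) = 0"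
    using i[of ?p] i[of ?m] integral_sin_int[of ?p] integral_sin_int[of ?m] by auto
qed

text \<open>Absolute convergence permits termwise integration, and orthogonality leaves a single
  term.\<close>

lemma trig_series_coeffs:
  fixes a b :: "nat \<Rightarrow> real"
  assumes a: "summable (\<lambda>k. \<bar>a k\<bar>)" and b: "summable (\<lambda>k. \<bar>b k\<bar>)"
  defines "f \<equiv> \<lambda>t. \<Sum>k. a k * cos (real k * t) + b k * sin (real k * t)"
  shows "(LINT t|per_measure. f t * cos (real j * t)) = (if j = 0 then 2 * pi else pi) * a j"
    and "(LINT t|per_measure. f t * sin (real j * t)) = (if j = 0 then 0 else pi) * b j"
proof -
  let ?u = "\<lambda>k t. a k * cos (real k * t) + b k * sin (real k * t)"
  have um: "?u k \<in> borel_measurable per_measure" for k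
    by (intro lebesgue_imp_per_measurable continuous_imp_lebesgue_measurable continuous_intros)
  have ub: "\<bar>?u k t\<bar> \<le> \<bar>a k\<bar> + \<bar>b k\<bar>" for k t
  proof -
    have "\<bar>?u k t\<bar> \<le> \<bar>a k * cos (real k * t)\<bar> + \<bar>b k * sin (real k * t)\<bar>" by (rule abs_triangle_ineq)
    also have "\<dots> \<le> \<bar>a k\<bar> + \<bar>b k\<bar>" by (intro add_mono) (auto simp: abs_mult intro: mult_left_le)
    finally show ?thesis .
  qed
  have sums: "(\<lambda>k. LINT t|per_measure. ?u k t * w t) sums (LINT t|per_measure. f t * w t)"
    if "continuous_on UNIV w" for w
    unfolding f_def
    by (rule integral_termwise[OF integrable_per_continuous[OF that] um ub summable_add[OF a b]])
  have i: "integrable per_measure (\<lambda>t. cos (real k * t) * cos (real j * t))"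
          "integrable per_measure (\<lambda>t. sin (real k * t) * cos (real j * t))"
          "integrable per_measure (\<lambda>t. cos (real k * t) * sin (real j * t))"
          "integrable per_measure (\<lambda>t. sin (real k * t) * sin (real j * t))" for k
    by (intro integrable_per_continuous continuous_intros)+
  have "(LINT t|per_measure. ?u k t * cos (real j * t)) =
      (if k = j then (if j = 0 then 2 * pi else pi) * a j else 0)" for k
  proof -
    have "(LINT t|per_measure. ?u k t * cos (real j * t)) =
      (LINT t|per_measure. a k * (cos (real k * t) * cos (real j * t)) + b k * (sin (real k * t) * cos (real j * t)))"
      by (simp add: algebra_simps)
    also have "\<dots> = a k * (LINT t|per_measure. cos (real k * t) * cos (real j * t))
        + b k * (LINT t|per_measure. sin (real k * t) * cos (real j * t))"
      using i[of k] by simp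
    finally show ?thesis by (simp add: trig_orthogonal)
  qed
  then show "(LINT t|per_measure. f t * cos (real j * t)) = (if j = 0 then 2 * pi else pi) * a j"
    using sums[of "\<lambda>t. cos (real j * t)"] sums_single[of j "\<lambda>_. (if j = 0 then 2 * pi else pi) * a j"]
    by (simp add: sums_unique2 continuous_intros cong: if_cong)
  have "(LINT t|per_measure. ?u k t * sin (real j * t)) =
      (if k = j then (if j = 0 then 0 else pi) * b j else 0)" for k
  proof -
    have "(LINT t|per_measure. ?u k t * sin (real j * t)) =
      (LINT t|per_measure. a k * (cos (real k * t) * sin (real j * t)) + b k * (sin (real k * t) * sin (real j * t)))"
      by (simp add: algebra_simps)
    also have "\<dots> = a k * (LINT t|per_measure. sin (real j * t) * cos (real k * t))
        + b k * (LINT t|per_measure. sin (real k * t) * sin (real j * t))"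
      using i[of k] by (simp add: mult.commute)
    finally show ?thesis by (simp add: trig_orthogonal)
  qed
  then show "(LINT t|per_measure. f t * sin (real j * t)) = (if j = 0 then 0 else pi) * b j"
    using sums[of "\<lambda>t. sin (real j * t)"] sums_single[of j "\<lambda>_. (if j = 0 then 0 else pi) * b j"]
    by (simp add: sums_unique2 continuous_intros cong: if_cong)
qed

text \<open>The given series is the Fourier series of \<open>f\<close>, so the partial sum of order
  \<open>m\<close> is the segment of indices below \<open>Suc m\<close> and only the tail
  remains.\<close>

lemma trig_series_partial_sum:
  fixes a b :: "nat \<Rightarrow> real"
  assumes a: "summable (\<lambda>k. \<bar>a k\<bar>)" and b: "summable (\<lambda>k. \<bar>b k\<bar>)" and b0: "b 0 = 0"
    and f: "\<And>t. f t = (\<Sum>k. a k * cos (real k * t) + b k * sin (real k * t))"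
  shows "f x - fourier_partial_sum m f x =
    (\<Sum>j. a (Suc m + j) * cos (real (Suc m + j) * x) + b (Suc m + j) * sin (real (Suc m + j) * x))"
proof -
  let ?u = "\<lambda>k. a k * cos (real k * x) + b k * sin (real k * x)"
  have feq: "f = (\<lambda>t. \<Sum>k. a k * cos (real k * t) + b k * sin (real k * t))" using f by blast
  have ab: "summable (\<lambda>k. \<bar>a k\<bar> + \<bar>b k\<bar>)" using a b by (rule summable_add)
  have su: "summable ?u"
  proof (rule summable_comparison_test'[OF ab, of 0])
    fix k
    have "\<bar>?u k\<bar> \<le> \<bar>a k * cos (real k * x)\<bar> + \<bar>b k * sin (real k * x)\<bar>" by (rule abs_triangle_ineq)
    also have "\<dots> \<le> \<bar>a k\<bar> + \<bar>b k\<bar>" by (intro add_mono) (auto simp: abs_mult intro: mult_left_le)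
    finally show "norm (?u k) \<le> \<bar>a k\<bar> + \<bar>b k\<bar>" by simp
  qed
  have "fourier_partial_sum m f x = a 0 + (\<Sum>k=1..m. ?u k)"
    unfolding fourier_partial_sum_def fourier_cos_coeff_def fourier_sin_coeff_def
    using trig_series_coeffs[OF a b] trig_series_coeffs(1)[OF a b, of 0]
    by (auto simp: feq intro!: sum.cong)
  also have "\<dots> = (\<Sum>k<Suc m. ?u k)"
    using b0 by (simp add: lessThan_Suc_atMost sum.atLeast1_atMost_eq sum.atMost_shift)
  finally have "fourier_partial_sum m f x = (\<Sum>k<Suc m. ?u k)" .
  moreover have "f x = (\<Sum>j. ?u (j + Suc m)) + (\<Sum>k<Suc m. ?u k)"
    unfolding f by (rule suminf_split_initial_segment[OF su])
  ultimately show ?thesis by (simp add: add.commute)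
qed

text \<open>The addition theorem separates \<open>x\<close> from \<open>t\<close>, which makes the
  convolution a trigonometric series in \<open>x\<close> with integrals of \<open>\<phi>\<close> as
  coefficients.\<close>

lemma cos_series_convolution:
  assumes c: "summable (\<lambda>j. \<bar>c j\<bar>)" and phi: "integrable per_measure \<phi>"
  shows "(LINT t|per_measure. \<phi> t * cos_series c m g (x - t)) =
    (\<Sum>j. c j * (LINT t|per_measure. \<phi> t * cos (real (m + j) * t + g)) * cos (real (m + j) * x)
       + c j * (LINT t|per_measure. \<phi> t * sin (real (m + j) * t + g)) * sin (real (m + j) * x))"
proof -
  let ?u = "\<lambda>j t. c j * cos (real (m + j) * (x - t) - g)"
  have um: "?u k \<in> borel_measurable per_measure" for k
    by (intro lebesgue_imp_per_measurable continuous_imp_lebesgue_measurable continuous_intros)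
  have ub: "\<bar>?u k t\<bar> \<le> \<bar>c k\<bar>" for k t by (auto simp: abs_mult intro: mult_left_le)
  have 1: "(\<lambda>j. LINT t|per_measure. ?u j t * \<phi> t) sums (LINT t|per_measure. cos_series c m g (x - t) * \<phi> t)"
    unfolding cos_series_def by (rule integral_termwise[OF phi um ub c])
  have i: "integrable per_measure (\<lambda>t. \<phi> t * w t)"
    if "continuous_on UNIV w" "\<And>t. \<bar>w t\<bar> \<le> 1" for w :: "real \<Rightarrow> real"
  proof (rule Bochner_Integration.integrable_bound[OF phi])
    have [measurable]: "w \<in> borel_measurable per_measure" "\<phi> \<in> borel_measurable per_measure"
      using that phi by (auto intro!: lebesgue_imp_per_measurable continuous_imp_lebesgue_measurable)
    show "(\<lambda>t. \<phi> t * w t) \<in> borel_measurable per_measure" by measurable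
  qed (auto simp: abs_mult intro!: mult_left_le that)
  have "(LINT t|per_measure. ?u j t * \<phi> t) =
      c j * (LINT t|per_measure. \<phi> t * cos (real (m + j) * t + g)) * cos (real (m + j) * x)
       + c j * (LINT t|per_measure. \<phi> t * sin (real (m + j) * t + g)) * sin (real (m + j) * x)" for j
  proof -
    have "cos (real (m + j) * (x - t) - g) = cos (real (m + j) * x) * cos (real (m + j) * t + g)
        + sin (real (m + j) * x) * sin (real (m + j) * t + g)" for t
      using cos_diff[of "real (m + j) * x" "real (m + j) * t + g"] by (simp add: algebra_simps)
    then have "(LINT t|per_measure. ?u j t * \<phi> t) = (LINT t|per_measure.
        (c j * cos (real (m + j) * x)) * (\<phi> t * cos (real (m + j) * t + g))
        + (c j * sin (real (m + j) * x)) * (\<phi> t * sin (real (m + j) * t + g)))"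
      by (intro Bochner_Integration.integral_cong refl) (simp only:, simp only: algebra_simps)
    also have "\<dots> = (c j * cos (real (m + j) * x)) * (LINT t|per_measure. \<phi> t * cos (real (m + j) * t + g))
        + (c j * sin (real (m + j) * x)) * (LINT t|per_measure. \<phi> t * sin (real (m + j) * t + g))"
      by (subst Bochner_Integration.integral_add)
         (auto intro!: integrable_mult_right i continuous_intros)
    finally show ?thesis by (simp only: mult.assoc mult.commute mult.left_commute)
  qed
  then show ?thesis using sums_unique[OF 1] by (simp add: mult.commute)
qed

subsection \<open>The Fourier remainder as a convolution\<close>

lemma unit_ball_mean_zero_iff:
  "\<phi> \<in> unit_ball_mean_zero \<longleftrightarrow> periodic_2pi \<phi> \<and> integrable per_measure \<phi> \<and>
    (LINT t|per_measure. \<bar>\<phi> t\<bar>) \<le> 1 \<and> (LINT t|per_measure. \<phi> t) = 0"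
proof -
  have 1: "p_norm 1 \<phi> \<le> 1 \<longleftrightarrow> (\<integral>\<^sup>+ t. ennreal \<bar>\<phi> t\<bar> \<partial>per_measure) \<le> 1"
    using p_norm_finite_le_iff[of 1 1 \<phi>] by (simp add: one_ereal_def)
  have 2: "(\<integral>\<^sup>+ t. ennreal \<bar>\<phi> t\<bar> \<partial>per_measure) \<le> 1 \<longleftrightarrow> (LINT t|per_measure. \<bar>\<phi> t\<bar>) \<le> 1"
    if "integrable per_measure \<phi>"
    using nn_integral_eq_integral[OF integrable_abs[OF that]] by (simp add: integral_nonneg)
  have 3: "p_norm 1 \<phi> < \<infinity>" if "p_norm 1 \<phi> \<le> 1" using that by (auto simp: top.not_eq_extremum)
  have 4: "integrable per_measure \<phi>"
    if "\<phi> \<in> borel_measurable per_measure" "(\<integral>\<^sup>+ t. ennreal \<bar>\<phi> t\<bar> \<partial>per_measure) \<le> 1"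
    using that by (auto simp: integrable_iff_bounded intro: le_less_trans)
  have 5: "\<phi> \<in> borel_measurable per_measure" if "integrable per_measure \<phi>"
    using that by (rule borel_measurable_integrable)
  show ?thesis
    unfolding unit_ball_mean_zero_def L_space_def mem_Collect_eq using 1 2 3 4 5 by argo
qed

lemma integrable_times_bounded:
  fixes \<phi> w :: "real \<Rightarrow> real"
  assumes phi: "integrable per_measure \<phi>" and w: "w \<in> borel_measurable per_measure"
    and b: "\<And>t. \<bar>w t\<bar> \<le> B"
  shows "integrable per_measure (\<lambda>t. \<phi> t * w t)"
    and "\<bar>LINT t|per_measure. \<phi> t * w t\<bar> \<le> B * (LINT t|per_measure. \<bar>\<phi> t\<bar>)"
proof -
  have [measurable]: "w \<in> borel_measurable per_measure" "\<phi> \<in> borel_measurable per_measure"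
    using w phi by auto
  have "B \<ge> 0" using b[of 0] by linarith
  show i: "integrable per_measure (\<lambda>t. \<phi> t * w t)"
    by (rule Bochner_Integration.integrable_bound[where f = "\<lambda>t. \<phi> t * B"])
       (use phi b \<open>B \<ge> 0\<close> in \<open>auto simp: abs_mult intro!: mult_left_mono\<close>)
  have "\<bar>LINT t|per_measure. \<phi> t * w t\<bar> \<le> (LINT t|per_measure. \<bar>\<phi> t * w t\<bar>)"
    using integral_norm_bound[of per_measure "\<lambda>t. \<phi> t * w t"] by simp
  also have "\<dots> \<le> (LINT t|per_measure. B * \<bar>\<phi> t\<bar>)"
    using i phi b
    by (intro integral_mono integrable_abs integrable_mult_right)
       (auto simp: abs_mult mult.commute[of B] intro!: mult_left_mono)
  finally show "\<bar>LINT t|per_measure. \<phi> t * w t\<bar> \<le> B * (LINT t|per_measure. \<bar>\<phi> t\<bar>)" by simp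
qed

text \<open>The class translates \<open>\<phi>\<close>. Substituting \<open>x - t\<close> over a
  period puts the translation on the kernel, the continuous factor, where it can be expanded and
  estimated.\<close>

lemma integral_convolution_commute:
  fixes \<phi> w :: "real \<Rightarrow> real"
  assumes phi: "integrable per_measure \<phi>" "periodic_2pi \<phi>"
    and w: "continuous_on UNIV w" "\<And>t. w (t + 2 * pi) = w t" "\<And>t. \<bar>w t\<bar> \<le> B"
  shows "(LINT t|per_measure. \<phi> (x - t) * w t) = (LINT t|per_measure. \<phi> t * w (x - t))"
proof -
  have per: "\<phi> (t + 2 * pi) = \<phi> t" for t using phi by (simp add: periodic_2pi_def)
  have [measurable]: "\<phi> \<in> borel_measurable lebesgue"
    using phi by (intro periodic_measurable per) auto
  have wc: "continuous_on UNIV (\<lambda>t. w (x - t))"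
    by (intro continuous_on_compose2[OF w(1)] continuous_intros) auto
  then have [measurable]: "(\<lambda>t. w (x - t)) \<in> borel_measurable lebesgue"
    by (rule continuous_imp_lebesgue_measurable)
  have "(LINT t|per_measure. \<phi> (x - t) * w (x - (x - t))) = (LINT t|per_measure. \<phi> t * w (x - t))"
  proof (rule integral_period_reflect(2)[where f = "\<lambda>t. \<phi> t * w (x - t)" and a = x])
    show "\<phi> (t + 2 * pi) * w (x - (t + 2 * pi)) = \<phi> t * w (x - t)" for t
      using w(2)[of "x - t - 2 * pi"] per[of t] by (simp add: algebra_simps)
    show "integrable per_measure (\<lambda>t. \<phi> t * w (x - t))"
      using phi w(3) wc
      by (intro integrable_times_bounded lebesgue_imp_per_measurable continuous_imp_lebesgue_measurable)
  qed measurable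
  then show ?thesis by simp
qed

section \<open>The coefficients of the tail kernel and the remainder formula\<close>

abbreviation weyl_coeff :: "real \<Rightarrow> nat \<Rightarrow> nat \<Rightarrow> real" where
  "weyl_coeff r n j \<equiv> real (n + j) powr (- r)"

lemma weyl_coeff_summable:
  assumes "r > 1"
  shows "summable (weyl_coeff r n)" "summable (\<lambda>j. \<bar>weyl_coeff r n j\<bar>)"
proof -
  have "summable (\<lambda>k. real k powr (- r))" using assms by (simp add: summable_real_powr_iff)
  from summable_ignore_initial_segment[OF this, of n]
  show "summable (weyl_coeff r n)" by (simp add: add.commute)
  then show "summable (\<lambda>j. \<bar>weyl_coeff r n j\<bar>)" by simp
qed

text \<open>Both \<open>f\<close> and the convolution of \<open>\<phi>\<close> with the tail kernel
  are expanded into trigonometric series. Their terms agree from index \<open>n\<close> on, and the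
  Fourier sum removes precisely the earlier ones.\<close>

lemma fourier_remainder:
  assumes r: "r > 1" and n: "n \<ge> 1" and phi: "\<phi> \<in> unit_ball_mean_zero"
    and f: "\<And>x. f x = a0 / 2 + 1 / pi * (LINT t|per_measure. \<phi> (x - t) * weyl_nagy_kernel r \<beta> t)"
  shows "f x - fourier_partial_sum (n - 1) f x =
    1 / pi * (LINT t|per_measure. \<phi> t * cos_series (weyl_coeff r n) n (\<beta> * pi / 2) (x - t))"
proof -
  define g where "g = \<beta> * pi / 2"
  have phi': "periodic_2pi \<phi>" "integrable per_measure \<phi>" "(LINT t|per_measure. \<bar>\<phi> t\<bar>) \<le> 1"
    using phi by (auto simp: unit_ball_mean_zero_iff)
  have K: "weyl_nagy_kernel r \<beta> = cos_series (weyl_coeff r 1) 1 g"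
    by (simp add: weyl_nagy_kernel_def cos_series_def fun_eq_iff g_def)
  \<comment> \<open>The kernel starts at harmonic 1, so index 0 carries only the additive constant
    of \<open>f\<close>.\<close>
  define a where "a = (\<lambda>k. if k = 0 then a0 / 2
    else 1 / pi * (real k powr (- r) * (LINT t|per_measure. \<phi> t * cos (real k * t + g))))"
  define b where "b = (\<lambda>k. if k = 0 then 0
    else 1 / pi * (real k powr (- r) * (LINT t|per_measure. \<phi> t * sin (real k * t + g))))"
  have cb: "\<bar>LINT t|per_measure. \<phi> t * w t\<bar> \<le> 1"
    if "continuous_on UNIV w" "\<And>t. \<bar>w t\<bar> \<le> 1" for w
    using integrable_times_bounded(2)[where B = 1 and w = w, OF phi'(2)
      lebesgue_imp_per_measurable[OF continuous_imp_lebesgue_measurable[OF that(1)]] that(2)] phi'(3)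
    by simp
  have sm: "summable (\<lambda>k. \<bar>d k\<bar>)"
    if "\<And>k. k \<noteq> 0 \<Longrightarrow> d k = 1 / pi * (real k powr (- r) * A k)" "\<And>k. \<bar>A k\<bar> \<le> 1" for d A :: "nat \<Rightarrow> real"
  proof (rule summable_comparison_test'[where N = 1])
    show "summable (\<lambda>k. 1 / pi * real k powr (- r))"
      using r by (intro summable_mult) (simp add: summable_real_powr_iff)
    show "norm \<bar>d k\<bar> \<le> 1 / pi * real k powr (- r)" if "k \<ge> 1" for k
    proof -
      have "\<bar>d k\<bar> = 1 / pi * (real k powr (- r) * \<bar>A k\<bar>)" using that \<open>\<And>k. k \<noteq> 0 \<Longrightarrow> d k = _\<close>[of k]
        by (simp add: abs_mult)
      also have "\<dots> \<le> 1 / pi * (real k powr (- r) * 1)"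
        using \<open>\<And>k. \<bar>A k\<bar> \<le> 1\<close>[of k] by (intro mult_left_mono) auto
      finally show ?thesis by simp
    qed
  qed
  have sa: "summable (\<lambda>k. \<bar>a k\<bar>)"
    by (rule sm[where A = "\<lambda>k. LINT t|per_measure. \<phi> t * cos (real k * t + g)"])
       (auto simp: a_def intro!: cb continuous_intros)
  have sb: "summable (\<lambda>k. \<bar>b k\<bar>)"
    by (rule sm[where A = "\<lambda>k. LINT t|per_measure. \<phi> t * sin (real k * t + g)"])
       (auto simp: b_def intro!: cb continuous_intros)
  let ?u = "\<lambda>x k. a k * cos (real k * x) + b k * sin (real k * x)"
  have su: "summable (?u x)" for x
  proof (rule summable_add)
    show "summable (\<lambda>k. a k * cos (real k * x))"
      using cos_series_summable(2)[OF sa, of 0 x 0] by simp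
    show "summable (\<lambda>k. b k * sin (real k * x))"
      using cos_series_summable(2)[OF sb, of 0 x "pi / 2"] by (simp add: cos_diff)
  qed
  \<comment> \<open>Used twice: \<open>m = 1\<close> recovers \<open>f\<close>, and
    \<open>m = n\<close> gives the tail.\<close>
  have conv: "1 / pi * (LINT t|per_measure. \<phi> t * cos_series (weyl_coeff r m) m g (x - t)) =
      (\<Sum>j. ?u x (m + j))" if "m \<ge> 1" for m x
  proof -
    have s: "summable (\<lambda>j. ?u x (m + j))"
      using summable_ignore_initial_segment[OF su[of x], of m] by (simp add: add.commute)
    have "(LINT t|per_measure. \<phi> t * cos_series (weyl_coeff r m) m g (x - t)) = (\<Sum>j. pi * ?u x (m + j))"
      unfolding cos_series_convolution[OF weyl_coeff_summable(2)[OF r] phi'(2)]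
      using that by (intro suminf_cong) (simp add: a_def b_def algebra_simps)
    also have "\<dots> = pi * (\<Sum>j. ?u x (m + j))" by (rule suminf_mult[OF s])
    finally show ?thesis by simp
  qed
  have ft: "f t = (\<Sum>k. ?u t k)" for t
  proof -
    have "f t = a0 / 2 + 1 / pi * (LINT s|per_measure. \<phi> s * cos_series (weyl_coeff r 1) 1 g (t - s))"
      unfolding f K
      integral_convolution_commute[OF phi'(2,1) cos_series_continuous[OF weyl_coeff_summable(2)[OF r]]
          cos_series_periodic cos_series_bound[OF weyl_coeff_summable(2)[OF r]]] ..
    also have "\<dots> = ?u t 0 + (\<Sum>j. ?u t (Suc j))" using conv[of 1 t] by (simp add: a_def b_def)
    also have "\<dots> = (\<Sum>k. ?u t k)" using suminf_split_head[OF su[of t]] by simp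
    finally show ?thesis .
  qed
  \<comment> \<open>Order \<open>n - 1\<close> comprises the harmonics below \<open>n\<close>; the
    subtraction is not truncated because \<open>n \<ge> 1\<close>.\<close>
  have n': "Suc (n - 1) = n" using n by (rule Suc_diff_1[OF less_le_trans[OF zero_less_one]])
  have b0: "b 0 = 0" by (simp add: b_def)
  have "f x - fourier_partial_sum (n - 1) f x = (\<Sum>j. ?u x (n + j))"
    unfolding trig_series_partial_sum[OF sa sb b0 ft] n' ..
  then show ?thesis unfolding g_def[symmetric] conv[OF n] .
qed

text \<open>The remainder does not see the constant \<open>a0\<close>, so the supremum runs over
  \<open>\<phi>\<close> alone; conversely each \<open>\<phi>\<close> is realised with
  \<open>a0 = 0\<close>.\<close>

lemma fourier_error_eq:
  assumes "r > 1" "n \<ge> 1"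
  shows "fourier_error n (weyl_nagy_class r \<beta>) s =
    (SUP \<phi> \<in> unit_ball_mean_zero. p_norm s (\<lambda>x. 1 / pi *
      (LINT t|per_measure. \<phi> t * cos_series (weyl_coeff r n) n (\<beta> * pi / 2) (x - t))))"
proof -
  let ?G = "\<lambda>\<phi> x. 1 / pi * (LINT t|per_measure. \<phi> t * cos_series (weyl_coeff r n) n (\<beta> * pi / 2) (x - t))"
  let ?R = "\<lambda>f x. f x - fourier_partial_sum (n - 1) f x"
  have "?R ` weyl_nagy_class r \<beta> = ?G ` unit_ball_mean_zero"
  proof (intro equalityI subsetI)
    fix h assume "h \<in> ?R ` weyl_nagy_class r \<beta>"
    then obtain f a0 \<phi> where h: "h = ?R f" and phi: "\<phi> \<in> unit_ball_mean_zero"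
      and f: "\<And>x. f x = a0 / 2 + 1 / pi * (LINT t|per_measure. \<phi> (x - t) * weyl_nagy_kernel r \<beta> t)"
      by (auto simp: weyl_nagy_class_def)
    have "h = ?G \<phi>" unfolding h using fourier_remainder[OF assms phi f] by blast
    then show "h \<in> ?G ` unit_ball_mean_zero" using phi by blast
  next
    fix h assume "h \<in> ?G ` unit_ball_mean_zero"
    then obtain \<phi> where h: "h = ?G \<phi>" and phi: "\<phi> \<in> unit_ball_mean_zero" by blast
    define f where "f = (\<lambda>x. 0 / 2 + 1 / pi * (LINT t|per_measure. \<phi> (x - t) * weyl_nagy_kernel r \<beta> t))"
    have "\<phi> (x - t + 2 * pi) = \<phi> (x - t)" for x t
      using phi unfolding unit_ball_mean_zero_iff periodic_2pi_def by blast
    then have "\<phi> (x + 2 * pi - t) = \<phi> (x - t)" for x t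
      by (simp only: diff_add_eq)
    then have "periodic_2pi f" by (simp add: periodic_2pi_def f_def)
    then have "f \<in> weyl_nagy_class r \<beta>"
      unfolding weyl_nagy_class_def using phi by (auto simp: f_def intro!: exI[of _ 0] bexI[of _ \<phi>])
    moreover have "h = ?R f"
      unfolding h using fourier_remainder[OF assms phi, of f 0 \<beta>] by (auto simp: f_def)
    ultimately show "h \<in> ?R ` weyl_nagy_class r \<beta>" by blast
  qed
  from arg_cong[OF this, of "\<lambda>S. Sup (p_norm s ` S)"]
  show ?thesis unfolding fourier_error_def by (simp only: image_image)
qed

subsection \<open>Convolution inequality and near-extremal functions\<close>

lemma sigma_finite_per_measure: "sigma_finite_measure per_measure"
  by (intro finite_measure.axioms(1) finite_measure_lebesgue_on) simp

lemma pair_sigma_finite_per_measure: "pair_sigma_finite per_measure per_measure"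
  using sigma_finite_per_measure by (simp add: pair_sigma_finite_def)

lemma measurable_per_borel: "(\<lambda>x::real. x) \<in> per_measure \<rightarrow>\<^sub>M borel"
  by (rule lebesgue_imp_per_measurable) measurable

text \<open>\<open>\<phi>\<close> is only Lebesgue measurable, so it is evaluated at a single
  coordinate. The factor evaluated at \<open>x - t\<close> is continuous, hence Borel, and may be
  composed with the subtraction.\<close>

lemma measurable_conv_kernel:
  fixes \<phi> w :: "real \<Rightarrow> real"
  assumes [measurable]: "\<phi> \<in> borel_measurable per_measure" and w: "continuous_on UNIV w"
  shows "(\<lambda>(x, t). \<phi> t * w (x - t)) \<in> borel_measurable (per_measure \<Otimes>\<^sub>M per_measure)"
proof -
  have [measurable]: "w \<in> borel_measurable borel" using w by (rule borel_measurable_continuous_onI)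
  note measurable_per_borel[measurable]
  have [measurable]: "(\<lambda>p. fst p) \<in> borel_measurable (per_measure \<Otimes>\<^sub>M per_measure)"
    "(\<lambda>p. snd p) \<in> borel_measurable (per_measure \<Otimes>\<^sub>M per_measure)"
    using measurable_compose[OF measurable_fst measurable_per_borel]
      measurable_compose[OF measurable_snd measurable_per_borel] by auto
  have [measurable]: "(\<lambda>p. \<phi> (snd p)) \<in> borel_measurable (per_measure \<Otimes>\<^sub>M per_measure)"
    by measurable
  have "(\<lambda>p. \<phi> (snd p) * w (fst p - snd p)) \<in> borel_measurable (per_measure \<Otimes>\<^sub>M per_measure)"
    by measurable
  then show ?thesis by (simp add: case_prod_unfold)
qed

lemma convolution_measurable:
  fixes \<phi> w :: "real \<Rightarrow> real"
  assumes "\<phi> \<in> borel_measurable per_measure" "continuous_on UNIV w"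
  shows "(\<lambda>x. LINT t|per_measure. \<phi> t * w (x - t)) \<in> borel_measurable per_measure"
  using sigma_finite_measure.borel_measurable_lebesgue_integral[OF sigma_finite_per_measure
    measurable_conv_kernel[OF assms]] .

text \<open>The weight has mass at most one, so Jensen's inequality becomes the tangent inequality at the mean.\<close>

lemma weighted_powr_integral_le:
  fixes w :: "real \<Rightarrow> real"
  assumes phi: "integrable M \<phi>" "(LINT t|M. \<bar>\<phi> t\<bar>) \<le> 1" and p: "p \<ge> 1"
    and i1: "integrable M (\<lambda>t. \<phi> t * w t)" and i2: "integrable M (\<lambda>t. \<bar>\<phi> t\<bar> * \<bar>w t\<bar> powr p)"
  shows "\<bar>LINT t|M. \<phi> t * w t\<bar> powr p \<le> (LINT t|M. \<bar>\<phi> t\<bar> * \<bar>w t\<bar> powr p)"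
proof -
  define V where "V = (LINT t|M. \<bar>\<phi> t\<bar> * \<bar>w t\<bar>)"
  define m where "m = (LINT t|M. \<bar>\<phi> t\<bar>)"
  have i3: "integrable M (\<lambda>t. \<bar>\<phi> t\<bar> * \<bar>w t\<bar>)" using integrable_abs[OF i1] by (simp add: abs_mult)
  have V0: "V \<ge> 0" unfolding V_def by (intro Bochner_Integration.integral_nonneg) auto
  have le: "\<bar>LINT t|M. \<phi> t * w t\<bar> \<le> V"
    unfolding V_def using integral_norm_bound[of M "\<lambda>t. \<phi> t * w t"] by (simp add: abs_mult)
  have m: "m \<le> 1" using phi by (simp add: m_def)
  show ?thesis
  proof (cases "V = 0")
    case True
    then show ?thesis using le by (simp add: Bochner_Integration.integral_nonneg)
  next
    case False
    then have V: "V > 0" using V0 by simp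
    then have vv: "V powr p = V * V powr (p - 1)" by (simp add: powr_mult_base)
    have "V powr p * 1 \<le> V powr p * (m + p * (1 - m))"
      using m p mult_right_mono[of 1 p "1 - m"] by (intro mult_left_mono) auto
    also have "\<dots> = V powr p * m + p * V powr (p - 1) * (V - V * m)"
      unfolding vv by (simp add: algebra_simps)
    also have "\<dots> = (LINT t|M. V powr p * \<bar>\<phi> t\<bar> + p * V powr (p - 1) * (\<bar>\<phi> t\<bar> * \<bar>w t\<bar> - V * \<bar>\<phi> t\<bar>))"
      using phi i3 by (simp add: m_def V_def)
    also have "\<dots> \<le> (LINT t|M. \<bar>\<phi> t\<bar> * \<bar>w t\<bar> powr p)"
    proof (rule integral_mono)
      show "integrable M (\<lambda>t. V powr p * \<bar>\<phi> t\<bar> + p * V powr (p - 1) * (\<bar>\<phi> t\<bar> * \<bar>w t\<bar> - V * \<bar>\<phi> t\<bar>))"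
        using phi i3 by simp
      fix t
      have "\<bar>\<phi> t\<bar> * (V powr p + p * V powr (p - 1) * (\<bar>w t\<bar> - V)) \<le> \<bar>\<phi> t\<bar> * \<bar>w t\<bar> powr p"
        using V p by (intro mult_left_mono powr_tangent) auto
      then show "V powr p * \<bar>\<phi> t\<bar> + p * V powr (p - 1) * (\<bar>\<phi> t\<bar> * \<bar>w t\<bar> - V * \<bar>\<phi> t\<bar>) \<le> \<bar>\<phi> t\<bar> * \<bar>w t\<bar> powr p"
        by (simp add: algebra_simps)
    qed (rule i2)
    finally show ?thesis using powr_mono2[of p, OF _ _ le] p by simp
  qed
qed

text \<open>Young's inequality with an integrable factor of norm at most one. For finite exponents:
  Jensen's inequality at each \<open>x\<close>, then Fubini and translation invariance. For
  \<open>s = \<infinity>\<close>: the essential bound of \<open>w\<close> is integrated against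
  \<open>\<phi>\<close>.\<close>

lemma p_norm_convolution_le:
  assumes s: "s \<ge> 1" and phi: "integrable per_measure \<phi>" "(LINT t|per_measure. \<bar>\<phi> t\<bar>) \<le> 1"
    and w: "continuous_on UNIV w" "\<And>t. w (t + 2 * pi) = w t" "\<And>t. \<bar>w t\<bar> \<le> B"
  shows "p_norm s (\<lambda>x. LINT t|per_measure. \<phi> t * w (x - t)) \<le> p_norm s w"
proof -
  let ?F = "\<lambda>x. LINT t|per_measure. \<phi> t * w (x - t)"
  have wm: "w \<in> borel_measurable lebesgue" using w by (intro continuous_imp_lebesgue_measurable)
  have phim[measurable]: "\<phi> \<in> borel_measurable per_measure" using phi by auto
  have Fm[measurable]: "?F \<in> borel_measurable per_measure"
    using phim w(1) by (rule convolution_measurable)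
  have wx: "continuous_on UNIV (\<lambda>t. w (x - t))" for x
    by (intro continuous_on_compose2[OF w(1)] continuous_intros) auto
  have wxm: "(\<lambda>t. w (x - t)) \<in> borel_measurable lebesgue" for x
    using wx by (rule continuous_imp_lebesgue_measurable)
  show ?thesis
  proof (cases "s = \<infinity>")
    case True
    define N where "N = esssup per_measure (\<lambda>t. ereal \<bar>w t\<bar>)"
    have "esssup per_measure (\<lambda>t. ereal \<bar>?F t\<bar>) \<le> N"
    proof (rule esssup_I)
      show "AE x in per_measure. ereal \<bar>?F x\<bar> \<le> N"
      proof (rule AE_I2)
        fix x
        have "N \<le> ereal B" unfolding N_def
          using w(3) wm by (intro esssup_I) (auto simp: lebesgue_imp_per_measurable)
        \<comment> \<open>The period has positive measure, so the essential supremum of a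
          nonnegative function cannot be negative; together with the bound \<open>B\<close> this
          makes \<open>N\<close> a real number.\<close>
        moreover have "0 \<le> N"
        proof -
          have "esssup per_measure (\<lambda>t. 0::ereal) \<le> N" unfolding N_def by (rule esssup_mono) auto
          then show ?thesis
            using esssup_const[of per_measure "0::ereal"] emeasure_per_measure pi_gt_zero by simp
        qed
        ultimately obtain b where b: "N = ereal b" "b \<ge> 0" by (cases N) auto
        have "AE t in per_measure. \<bar>w t\<bar> \<le> b"
          using esssup_AE[of "\<lambda>t. ereal \<bar>w t\<bar>" per_measure] b by (simp add: N_def)
        \<comment> \<open>The almost-everywhere bound is encoded as a vanishing integral, so that
          invariance under reflection carries it from \<open>w\<close> to its reflected
          translate.\<close>
        then have "(\<integral>\<^sup>+t. ennreal (max 0 (\<bar>w t\<bar> - b)) \<partial>per_measure) = 0"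
          by (subst nn_integral_0_iff_AE) (use lebesgue_imp_per_measurable[OF wm] in auto)
        also have "(\<integral>\<^sup>+t. ennreal (max 0 (\<bar>w t\<bar> - b)) \<partial>per_measure) =
            (\<integral>\<^sup>+t. ennreal (max 0 (\<bar>w (x - t)\<bar> - b)) \<partial>per_measure)"
          by (rule nn_integral_period_reflect[symmetric]) (use wm w(2) in auto)
        finally have AE: "AE t in per_measure. \<bar>w (x - t)\<bar> \<le> b"
          by (subst (asm) nn_integral_0_iff_AE)
             (use lebesgue_imp_per_measurable[OF wxm] in auto)
        have i: "integrable per_measure (\<lambda>t. \<phi> t * w (x - t))"
          using phi(1) lebesgue_imp_per_measurable[OF wxm] w(3) by (rule integrable_times_bounded)
        have "\<bar>?F x\<bar> \<le> (LINT t|per_measure. \<bar>\<phi> t * w (x - t)\<bar>)"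
          using integral_norm_bound[of per_measure "\<lambda>t. \<phi> t * w (x - t)"] by simp
        also have "\<dots> \<le> (LINT t|per_measure. b * \<bar>\<phi> t\<bar>)"
        proof (rule integral_mono_AE)
          show "AE t in per_measure. \<bar>\<phi> t * w (x - t)\<bar> \<le> b * \<bar>\<phi> t\<bar>"
            using AE by eventually_elim (auto simp: abs_mult mult.commute[of b] intro!: mult_left_mono)
        qed (use i phi in auto)
        also have "\<dots> = b * (LINT t|per_measure. \<bar>\<phi> t\<bar>)" by simp
        also have "\<dots> \<le> b" using b(2) phi(2) by (intro mult_left_le)
        finally show "ereal \<bar>?F x\<bar> \<le> N" by (simp add: b)
      qed
    qed measurable
    then show ?thesis using True by (simp add: p_norm_def N_def)
  next
    case False
    then obtain p where p: "s = ereal p" "p \<ge> 1" using s by (cases s) (auto simp: one_ereal_def)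
    have B0: "B \<ge> 0" using w(3)[of 0] by linarith
    have wpc: "continuous_on UNIV (\<lambda>t. \<bar>w t\<bar> powr p)"
      using w(1) p by (intro continuous_intros continuous_on_powr') auto
    have "(\<lambda>(x, t). \<bar>\<phi> t\<bar> * (\<bar>w (x - t)\<bar> powr p)) \<in> borel_measurable (per_measure \<Otimes>\<^sub>M per_measure)"
      by (rule measurable_conv_kernel[OF _ wpc]) measurable
    then have meas: "(\<lambda>(x, t). ennreal (\<bar>\<phi> t\<bar> * (\<bar>w (x - t)\<bar> powr p)))
        \<in> borel_measurable (per_measure \<Otimes>\<^sub>M per_measure)"
      by (simp add: case_prod_unfold)
    define I where "I = (\<integral>\<^sup>+ t. ennreal (\<bar>w t\<bar> powr p) \<partial>per_measure)"
    have "(\<integral>\<^sup>+ x. ennreal (\<bar>?F x\<bar> powr p) \<partial>per_measure) \<le>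
        (\<integral>\<^sup>+ x. (\<integral>\<^sup>+ t. ennreal (\<bar>\<phi> t\<bar> * (\<bar>w (x - t)\<bar> powr p)) \<partial>per_measure) \<partial>per_measure)"
    proof (rule nn_integral_mono)
      fix x
      have i: "integrable per_measure (\<lambda>t. \<bar>\<phi> t\<bar> * (\<bar>w (x - t)\<bar> powr p))"
        using lebesgue_imp_per_measurable[OF wxm, of x] phi w(3) p
        by (intro integrable_times_bounded[where B = "B powr p"]) (auto intro!: powr_mono2)
      have "\<bar>?F x\<bar> powr p \<le> (LINT t|per_measure. \<bar>\<phi> t\<bar> * (\<bar>w (x - t)\<bar> powr p))"
        using phi p
        by (intro weighted_powr_integral_le i
            integrable_times_bounded[OF phi(1) lebesgue_imp_per_measurable[OF wxm] w(3)])
      then show "ennreal (\<bar>?F x\<bar> powr p) \<le> (\<integral>\<^sup>+ t. ennreal (\<bar>\<phi> t\<bar> * (\<bar>w (x - t)\<bar> powr p)) \<partial>per_measure)"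
        by (subst nn_integral_eq_integral[OF i]) (auto intro: ennreal_leI)
    qed
    also have "\<dots> = (\<integral>\<^sup>+ t. (\<integral>\<^sup>+ x. ennreal (\<bar>\<phi> t\<bar> * (\<bar>w (x - t)\<bar> powr p)) \<partial>per_measure) \<partial>per_measure)"
      by (rule pair_sigma_finite.Fubini'[OF pair_sigma_finite_per_measure meas, symmetric])
    also have "\<dots> = (\<integral>\<^sup>+ t. ennreal \<bar>\<phi> t\<bar> * I \<partial>per_measure)"
    proof (rule nn_integral_cong)
      fix t
      have m': "(\<lambda>x. w (x - t)) \<in> borel_measurable per_measure"
        by (intro lebesgue_imp_per_measurable continuous_imp_lebesgue_measurable
            continuous_on_compose2[OF w(1)] continuous_intros) auto
      have "(\<integral>\<^sup>+ x. ennreal (\<bar>\<phi> t\<bar> * (\<bar>w (x - t)\<bar> powr p)) \<partial>per_measure) =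
          ennreal \<bar>\<phi> t\<bar> * (\<integral>\<^sup>+ x. ennreal (\<bar>w (x - t)\<bar> powr p) \<partial>per_measure)"
        using m' by (simp add: ennreal_mult' nn_integral_cmult)
      also have "(\<integral>\<^sup>+ x. ennreal (\<bar>w (x - t)\<bar> powr p) \<partial>per_measure) = I"
        using nn_integral_period_shift[of "\<lambda>x. ennreal (\<bar>w x\<bar> powr p)" "- t"] wm w(2)
        by (simp add: I_def)
      finally show "(\<integral>\<^sup>+ x. ennreal (\<bar>\<phi> t\<bar> * (\<bar>w (x - t)\<bar> powr p)) \<partial>per_measure) = ennreal \<bar>\<phi> t\<bar> * I" .
    qed
    also have "\<dots> = (\<integral>\<^sup>+ t. ennreal \<bar>\<phi> t\<bar> \<partial>per_measure) * I" by (rule nn_integral_multc) measurable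
    also have "\<dots> \<le> 1 * I"
      using phi by (intro mult_right_mono)
        (auto simp: nn_integral_eq_integral[OF integrable_abs[OF phi(1)]] Bochner_Integration.integral_nonneg)
    finally have le: "(\<integral>\<^sup>+ x. ennreal (\<bar>?F x\<bar> powr p) \<partial>per_measure) \<le> I" by simp
    show ?thesis
    proof (cases "p_norm s w = \<infinity>")
      case False
      then obtain a where a: "p_norm s w = ereal a" "a \<ge> 0"
        by (auto simp: p p_norm_def Let_def split: if_splits)
      then have "I \<le> ennreal (a powr p)" using p p_norm_finite_le_iff[of p a w] by (simp add: I_def)
      then show ?thesis using le p_norm_finite_le_iff[of p a ?F] a p by simp
    qed simp
  qed
qed

text \<open>Lets the indicator of a short interval around 0 be written as a periodic
  function.\<close>

lemma cos_gt_cos_iff: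
  assumes "t \<in> {-pi..pi}" "0 < h" "h < pi"
  shows "cos t > cos h \<longleftrightarrow> t \<in> {-h<..<h}"
  using cos_mono_less_eq[of h "\<bar>t\<bar>"] assms by (cases "t \<ge> 0") auto

text \<open>The witness is half the difference of approximate unit masses at \<open>0\<close> and \<open>a\<close>.\<close>

lemma unit_ball_difference_approx:
  assumes w: "continuous_on UNIV w" "\<And>t. w (t + 2 * pi) = w t" "\<And>t. \<bar>w t\<bar> \<le> B" and e: "e > 0"
  obtains \<phi> where "\<phi> \<in> unit_ball_mean_zero"
    "\<And>x. \<bar>(LINT t|per_measure. \<phi> t * w (x - t)) - (w x - w (x - a)) / 2\<bar> \<le> e"
proof -
  \<comment> \<open>Periodicity brings \<open>x\<close> into one period; the doubled interval also
    contains the nearby point \<open>y - t\<close>.\<close>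
  have "uniformly_continuous_on {-2 * pi..2 * pi} w"
    by (intro compact_uniformly_continuous continuous_on_subset[OF w(1)]) auto
  then obtain d where d: "d > 0"
    "\<And>x y. x \<in> {-2 * pi..2 * pi} \<Longrightarrow> y \<in> {-2 * pi..2 * pi} \<Longrightarrow> dist y x < d \<Longrightarrow> dist (w y) (w x) < e"
    unfolding uniformly_continuous_on_def using e by metis
  define h where "h = min (d / 2) 1"
  have h: "0 < h" "h < pi" "h < d" using d pi_gt3 by (auto simp: h_def)
  have unif: "\<bar>w (x - t) - w x\<bar> \<le> e" if t: "\<bar>t\<bar> < h" for x t
  proof -
    define k where "k = \<lfloor>(x + pi) / (2 * pi)\<rfloor>"
    define y where "y = x + 2 * pi * of_int (- k)"
    have "of_int k \<le> (x + pi) / (2 * pi)" "(x + pi) / (2 * pi) < of_int k + 1"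
      unfolding k_def by linarith+
    then have y: "-pi \<le> y" "y \<le> pi" by (simp_all add: y_def field_simps)
    have "w (x - t) = w (y - t)" "w x = w y"
      using period_int[of w "x - t" "- k", OF w(2)] period_int[of w x "- k", OF w(2)]
      by (simp_all add: y_def algebra_simps)
    moreover have "dist (w (y - t)) (w y) < e"
      using y t h by (intro d(2)) (auto simp: dist_real_def)
    ultimately show ?thesis by (simp add: dist_real_def)
  qed
  \<comment> \<open>The condition on the cosine makes this indicator of \<open>{-h<..<h}\<close>
    periodic by construction.\<close>
  define \<psi> :: "real \<Rightarrow> real" where "\<psi> = (\<lambda>t. if cos t > cos h then 1 else 0)"
  have psi_borel[measurable]: "\<psi> \<in> borel_measurable borel" unfolding \<psi>_def by measurable
  have psi_leb[measurable]: "\<psi> \<in> borel_measurable lebesgue"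
    using psi_borel by (simp add: measurable_completion)
  have psi_per: "\<psi> (t + 2 * pi) = \<psi> t" for t by (simp add: \<psi>_def)
  have fin: "finite_measure per_measure" by (rule finite_measure_lebesgue_on) simp
  have psi_int: "integrable per_measure \<psi>"
    by (rule finite_measure.integrable_const_bound[OF fin, of _ 1])
       (auto simp: \<psi>_def intro!: lebesgue_imp_per_measurable[OF psi_leb[unfolded \<psi>_def]])
  have psi_eq: "\<psi> t = indicator {-h<..<h} t" if "t \<in> {-pi..pi}" for t
    using cos_gt_cos_iff[OF that h(1,2)] by (simp add: \<psi>_def indicator_def)
  have psi_mass: "(LINT t|per_measure. \<psi> t) = 2 * h"
  proof -
    have "(LINT t|per_measure. \<psi> t) = (LINT t|per_measure. indicator {-h<..<h} t)"
      by (rule Bochner_Integration.integral_cong) (auto simp: psi_eq)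
    also have "\<dots> = measure per_measure ({-h<..<h} \<inter> space per_measure)" by simp
    also have "\<dots> = measure lebesgue {-h<..<h}"
    proof -
      have "{-h<..<h} \<subseteq> {-pi..pi}" using h by auto
      then show ?thesis by (subst measure_restrict_space) (auto simp: Int_absorb2)
    qed
    finally show ?thesis using h by simp
  qed
  have wint: "integrable per_measure (\<lambda>t. f t * w (x - t))" if "integrable per_measure f" for f x
    using that w(3)
    by (intro integrable_times_bounded lebesgue_imp_per_measurable continuous_imp_lebesgue_measurable
        continuous_on_compose2[OF w(1)] continuous_intros) auto
  have approx: "\<bar>(LINT t|per_measure. \<psi> t * w (x - t)) - 2 * h * w x\<bar> \<le> 2 * h * e" for x
  proof -
    have i1: "integrable per_measure (\<lambda>t. \<psi> t * (w (x - t) - w x))"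
      using wint[OF psi_int, of x] psi_int by (simp add: right_diff_distrib)
    have "(LINT t|per_measure. \<psi> t * w (x - t)) - 2 * h * w x =
        (LINT t|per_measure. \<psi> t * (w (x - t) - w x))"
      using wint[OF psi_int, of x] psi_int psi_mass by (simp add: right_diff_distrib)
    also have "\<bar>\<dots>\<bar> \<le> (LINT t|per_measure. \<bar>\<psi> t * (w (x - t) - w x)\<bar>)"
      using integral_norm_bound[of per_measure "\<lambda>t. \<psi> t * (w (x - t) - w x)"] by simp
    also have "\<dots> \<le> (LINT t|per_measure. e * \<psi> t)"
    proof (rule integral_mono)
      fix t assume "t \<in> space per_measure"
      then show "\<bar>\<psi> t * (w (x - t) - w x)\<bar> \<le> e * \<psi> t"
        using unif[of t x] psi_eq[of t] by (auto simp: indicator_def)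
    qed (use i1 psi_int in auto)
    also have "\<dots> = 2 * h * e" using psi_mass by simp
    finally show ?thesis .
  qed
  have sh: "integrable per_measure (\<lambda>t. \<psi> (t - a))" "(LINT t|per_measure. \<psi> (t - a)) = 2 * h"
    using integral_period_shift[OF psi_leb psi_per psi_int, of a] psi_mass by auto
  have shw: "(LINT t|per_measure. \<psi> (t - a) * w (x - t)) = (LINT t|per_measure. \<psi> t * w (x - a - t))" for x
  proof -
    have m: "(\<lambda>t. w (x - a - t)) \<in> borel_measurable lebesgue"
      by (intro continuous_imp_lebesgue_measurable continuous_on_compose2[OF w(1)] continuous_intros) auto
    have "(LINT t|per_measure. \<psi> (t - a) * w (x - a - (t - a))) = (LINT t|per_measure. \<psi> t * w (x - a - t))"
    proof (rule integral_period_shift(2)[where f = "\<lambda>t. \<psi> t * w (x - a - t)"])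
      show "\<psi> (t + 2 * pi) * w (x - a - (t + 2 * pi)) = \<psi> t * w (x - a - t)" for t
        using w(2)[of "x - a - t - 2 * pi"] psi_per[of t] by (simp add: algebra_simps)
    qed (use m wint[OF psi_int] in auto)
    then show ?thesis by simp
  qed
  \<comment> \<open>Each bump has mass \<open>2 * h\<close>, so the factor gives each a mass of one
    half; the integral of the absolute value is then at most 1 even if the bumps overlap.\<close>
  define \<phi> where "\<phi> = (\<lambda>t. 1 / (4 * h) * (\<psi> t - \<psi> (t - a)))"
  show ?thesis
  proof
    have per: "periodic_2pi \<phi>"
      using psi_per[of "t - a" for t] psi_per by (simp add: periodic_2pi_def \<phi>_def algebra_simps)
    have int: "integrable per_measure \<phi>" using psi_int sh by (simp add: \<phi>_def)
    have "(LINT t|per_measure. \<bar>\<phi> t\<bar>) \<le> (LINT t|per_measure. 1 / (4 * h) * (\<psi> t + \<psi> (t - a)))"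
    proof (rule integral_mono)
      fix t
      have "\<bar>\<psi> t - \<psi> (t - a)\<bar> \<le> \<psi> t + \<psi> (t - a)" by (auto simp: \<psi>_def)
      then show "\<bar>\<phi> t\<bar> \<le> 1 / (4 * h) * (\<psi> t + \<psi> (t - a))"
        using h by (simp add: \<phi>_def abs_mult divide_right_mono)
    qed (use int psi_int sh in auto)
    also have "\<dots> = 1" using psi_int sh psi_mass h by simp
    finally have l1: "(LINT t|per_measure. \<bar>\<phi> t\<bar>) \<le> 1" .
    have "(LINT t|per_measure. \<phi> t) = 0" using psi_int sh psi_mass by (simp add: \<phi>_def)
    with per int l1 show "\<phi> \<in> unit_ball_mean_zero" by (simp add: unit_ball_mean_zero_iff)
    fix x
    have "(LINT t|per_measure. \<phi> t * w (x - t)) =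
        (LINT t|per_measure. 1 / (4 * h) * (\<psi> t * w (x - t) - \<psi> (t - a) * w (x - t)))"
      by (simp only: \<phi>_def left_diff_distrib mult.assoc)
    also have "\<dots> = 1 / (4 * h) *
        ((LINT t|per_measure. \<psi> t * w (x - t)) - (LINT t|per_measure. \<psi> t * w (x - a - t)))"
      using wint[OF psi_int, of x] wint[OF sh(1), of x] by (simp add: shw[symmetric])
    also have "\<dots> - (w x - w (x - a)) / 2 = 1 / (4 * h) *
        (((LINT t|per_measure. \<psi> t * w (x - t)) - 2 * h * w x)
          - ((LINT t|per_measure. \<psi> t * w (x - a - t)) - 2 * h * w (x - a)))"
      using h by (simp add: field_simps)
    also have "\<bar>\<dots>\<bar> \<le> 1 / (4 * h) * (2 * h * e + 2 * h * e)"
    proof -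
      have "\<bar>((LINT t|per_measure. \<psi> t * w (x - t)) - 2 * h * w x)
          - ((LINT t|per_measure. \<psi> t * w (x - a - t)) - 2 * h * w (x - a))\<bar> \<le> 2 * h * e + 2 * h * e"
        by (rule order_trans[OF abs_triangle_ineq4 add_mono[OF approx approx]])
      then show ?thesis unfolding abs_mult using h by (intro mult_mono) auto
    qed
    also have "\<dots> = e" using h by (simp add: field_simps)
    finally show "\<bar>(LINT t|per_measure. \<phi> t * w (x - t)) - (w x - w (x - a)) / 2\<bar> \<le> e" .
  qed
qed

subsection \<open>Comparison of the coefficients with a geometric sequence\<close>

text \<open>Applied to \<open>x = r / n\<close>, which is at most 2 because
  \<open>r \<le> n + 1\<close>; the 3 bounds \<open>1 + x\<close> on that range.\<close>

lemma one_minus_exp_ge: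
  assumes "0 \<le> x" "x \<le> 2"
  shows "1 - exp (- x) \<ge> x / (3::real)"
proof -
  have e: "1 + x \<le> exp x" by (rule exp_ge_add_one_self)
  have "exp (- x) = 1 / exp x" by (simp add: exp_minus inverse_eq_divide)
  also have "\<dots> \<le> 1 / (1 + x)" using e assms by (intro divide_left_mono) auto
  finally have "1 - exp (- x) \<ge> 1 - 1 / (1 + x)" by simp
  moreover have "1 - 1 / (1 + x) = x / (1 + x)" using assms by (simp add: field_simps)
  moreover have "x / (1 + x) \<ge> x / 3" using assms by (intro divide_left_mono) auto
  ultimately show ?thesis by linarith
qed

text \<open>Telescoping: \<open>1 / (u + s)\<^sup>2\<close> is at most
  \<open>1 / (u * (u + s))\<close>, a multiple of a difference of consecutive reciprocals. The term
  \<open>j = 0\<close> contributes the 1.\<close>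

lemma inverse_square_suminf_le:
  fixes s :: real
  assumes "s > 0"
  shows "summable (\<lambda>j. 1 / (1 + s * real j)\<^sup>2)" "(\<Sum>j. 1 / (1 + s * real j)\<^sup>2) \<le> 1 + 1 / s"
proof -
  have part: "(\<Sum>j<Suc N. 1 / (1 + s * real j)\<^sup>2) \<le> 1 + (1 / s) * (1 - 1 / (1 + s * real N))" for N
  proof (induction N)
    case (Suc N)
    define u where "u = 1 + s * real N"
    have u: "u > 0" "1 + s * real (Suc N) = u + s" using assms by (auto simp: u_def algebra_simps add_pos_nonneg)
    have "1 / (u + s)\<^sup>2 \<le> 1 / (u * (u + s))"
      using u assms by (intro divide_left_mono) (auto simp: power2_eq_square)
    also have "\<dots> = (1 / s) * (1 / u - 1 / (u + s))"
      using u assms by (simp add: field_simps)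
    finally show ?case using Suc unfolding sum.lessThan_Suc[of _ "Suc N"] u(2)
      by (simp add: u_def[symmetric] right_diff_distrib)
  qed simp
  have bound: "(\<Sum>j<N. 1 / (1 + s * real j)\<^sup>2) \<le> 1 + 1 / s" for N
  proof (cases N)
    case 0
    then show ?thesis using assms by simp
  next
    case (Suc M)
    have "(1 / s) * (1 - 1 / (1 + s * real M)) \<le> (1 / s) * 1"
      using assms by (intro mult_left_mono) auto
    then show ?thesis using part[of M] Suc by simp
  qed
  show sm: "summable (\<lambda>j. 1 / (1 + s * real j)\<^sup>2)"
    by (rule summableI_nonneg_bounded[OF _ bound]) auto
  show "(\<Sum>j. 1 / (1 + s * real j)\<^sup>2) \<le> 1 + 1 / s"
    by (rule suminf_le_const[OF sm bound])
qed

text \<open>Write the power as \<open>exp (- (r * ln (1 + y)))\<close>. The exponents differ by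
  \<open>r * (y - ln (1 + y))\<close>, which lies between 0 and \<open>r * y\<^sup>2\<close>, and
  \<open>1 - exp (- x) \<le> x\<close>.\<close>

lemma powr_minus_exp_bounds:
  fixes y r :: real
  assumes "y \<ge> 0" "r \<ge> 0"
  shows "exp (- (r * y)) \<le> (1 + y) powr (- r)"
    and "(1 + y) powr (- r) - exp (- (r * y)) \<le> r * y\<^sup>2 * (1 + y) powr (- r)"
proof -
  have l: "ln (1 + y) \<le> y" using assms by (intro ln_add_one_self_le_self) auto
  have "ln (1 / (1 + y)) \<le> 1 / (1 + y) - 1" using assms by (intro ln_le_minus_one) auto
  then have "ln (1 + y) \<ge> 1 - 1 / (1 + y)" using assms by (simp add: ln_div)
  then have "y - ln (1 + y) \<le> y - 1 + 1 / (1 + y)" by simp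
  also have "\<dots> = y\<^sup>2 / (1 + y)" using assms by (simp add: field_simps power2_eq_square)
  also have "\<dots> \<le> y\<^sup>2" using assms mult_left_mono[of 1 "1 + y" "y\<^sup>2"] by (simp add: divide_le_eq)
  finally have l2: "y - ln (1 + y) \<le> y\<^sup>2" .
  have pw: "(1 + y) powr (- r) = exp (- (r * ln (1 + y)))" using assms by (simp add: powr_def)
  show "exp (- (r * y)) \<le> (1 + y) powr (- r)"
    unfolding pw using l assms by (simp add: mult_left_mono)
  have "exp (- (r * y)) = (1 + y) powr (- r) * exp (- (r * (y - ln (1 + y))))"
    unfolding pw exp_add[symmetric] by (simp add: algebra_simps)
  also have "\<dots> \<ge> (1 + y) powr (- r) * (1 - r * (y - ln (1 + y)))"
    using exp_ge_add_one_self[of "- (r * (y - ln (1 + y)))"] by (intro mult_left_mono) auto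
  finally have "(1 + y) powr (- r) - exp (- (r * y)) \<le> (1 + y) powr (- r) * (r * (y - ln (1 + y)))"
    by (simp add: algebra_simps)
  also have "\<dots> \<le> (1 + y) powr (- r) * (r * y\<^sup>2)"
    using l2 assms by (intro mult_left_mono) auto
  finally show "(1 + y) powr (- r) - exp (- (r * y)) \<le> r * y\<^sup>2 * (1 + y) powr (- r)"
    by (simp add: mult_ac)
qed

text \<open>By Bernoulli's inequality \<open>(1 + y) powr r \<ge> (1 + r y/4)^4\<close>: two factors absorb \<open>y\<^sup>2\<close>, two make the sum over \<open>y = j/n\<close> converge.\<close>

lemma powr_minus_exp_le_inverse_square:
  fixes y r :: real
  assumes y: "y \<ge> 0" and r: "r \<ge> 4"
  shows "(1 + y) powr (- r) - exp (- (r * y)) \<le> 16 / r * (1 / (1 + r / 4 * y)\<^sup>2)"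
proof -
  define u where "u = 1 + r / 4 * y"
  have u: "u \<ge> 1" "u > 0" using assms by (auto simp: u_def add_pos_nonneg)
  have "u \<le> (1 + y) powr (r / 4)" using powr_tangent[of "1 + y" 1 "r / 4"] assms by (simp add: u_def)
  then have "u ^ 4 \<le> ((1 + y) powr (r / 4)) ^ 4" using u by (intro power_mono) auto
  also have "\<dots> = (1 + y) powr r" using y by (simp add: powr_power)
  finally have "(1 + y) powr (- r) \<le> 1 / u ^ 4"
    using u y by (simp add: powr_minus inverse_eq_divide divide_left_mono)
  then have "r * y\<^sup>2 * (1 + y) powr (- r) \<le> r * y\<^sup>2 * (1 / u ^ 4)"
    using r by (intro mult_left_mono) auto
  also have "\<dots> \<le> r * (4 / r * u)\<^sup>2 * (1 / u ^ 4)"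
  proof (intro mult_right_mono mult_left_mono power_mono)
    have "y \<le> 4 / r * u" using r by (simp add: u_def field_simps)
    then show "y \<le> 4 / r * u" .
  qed (use r y u in auto)
  also have "\<dots> = 16 / r * (1 / u\<^sup>2)"
    using r u by (simp add: field_simps power2_eq_square power4_eq_xxxx)
  finally show ?thesis
    using powr_minus_exp_bounds(2)[of y r] assms by (simp add: u_def)
qed

lemma powr_minus_exp_le_inverse_square':
  fixes y r :: real
  assumes y: "y \<ge> 0" and r: "r \<ge> 2"
  shows "(1 + y) powr (- r) - exp (- (r * y)) \<le> 1 / (1 + y)\<^sup>2"
proof -
  have "(1 + y) powr (- r) \<le> (1 + y) powr (- 2)" using assms by (intro powr_mono) auto
  also have "\<dots> = 1 / (1 + y)\<^sup>2" using y by (simp add: powr_minus inverse_eq_divide)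
  finally show ?thesis using exp_ge_zero[of "- (r * y)"] by linarith
qed

section \<open>Translation of geometric cosine series, and their distance to the tail kernel\<close>

lemma geometric_deriv_suminf_le:
  fixes q :: real
  assumes "0 \<le> q" "q < 1"
  shows "summable (\<lambda>j. real j * q ^ j)" "(\<Sum>j. real j * q ^ j) \<le> 1 / (1 - q)\<^sup>2"
proof -
  have s: "(\<lambda>j. real (Suc j) * q ^ j) sums (1 / (1 - q)\<^sup>2)"
    using geometric_deriv_sums[of q] assms by simp
  have le: "real j * q ^ j \<le> real (Suc j) * q ^ j" for j using assms by (intro mult_right_mono) auto
  show sm: "summable (\<lambda>j. real j * q ^ j)"
    by (rule summable_comparison_test'[OF sums_summable[OF s], of 0]) (use le assms in auto)
  show "(\<Sum>j. real j * q ^ j) \<le> 1 / (1 - q)\<^sup>2"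
    using suminf_le[OF le sm sums_summable[OF s]] sums_unique[OF s] by simp
qed

lemma abs_cos_diff_le: "\<bar>cos x - cos y\<bar> \<le> \<bar>x - y\<bar>" for x y :: real
proof -
  have "\<bar>cos x - cos y\<bar> = 2 * \<bar>sin ((x + y) / 2)\<bar> * \<bar>sin ((y - x) / 2)\<bar>"
    by (simp add: cos_diff_cos abs_mult)
  also have "\<dots> \<le> 2 * 1 * \<bar>(y - x) / 2\<bar>"
    by (intro mult_mono abs_sin_x_le_abs_x) auto
  finally show ?thesis by simp
qed

lemma geometric_abs_summable:
  fixes q :: real
  assumes "0 \<le> q" "q < 1"
  shows "summable (\<lambda>j. \<bar>q ^ j\<bar>)"
  using assms by (simp add: summable_geometric power_abs[symmetric])

text \<open>Translation by \<open>s\<close> changes the phase of harmonic \<open>n + j\<close> by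
  \<open>(n + j) * s\<close>. The common part \<open>n * s\<close> is absorbed into
  \<open>g\<close>; the rest \<open>j * s\<close> costs at most its modulus, as \<open>cos\<close>
  is 1-Lipschitz, and the sum of \<open>j * q ^ j\<close> is at most
  \<open>1 / (1 - q)\<^sup>2\<close>.\<close>

lemma geometric_cos_series_shift:
  fixes q :: real
  assumes q: "0 \<le> q" "q < 1"
  shows "\<bar>cos_series (\<lambda>j. q ^ j) n g (t - s) - cos_series (\<lambda>j. q ^ j) n (g + real n * s) t\<bar> \<le> \<bar>s\<bar> / (1 - q)\<^sup>2"
proof -
  let ?d = "\<lambda>j. q ^ j * cos (real (n + j) * (t - s) - g) - q ^ j * cos (real (n + j) * t - (g + real n * s))"
  note gs = geometric_abs_summable[OF q]
  have b: "\<bar>?d j\<bar> \<le> \<bar>s\<bar> * (real j * q ^ j)" for j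
  proof -
    have "\<bar>?d j\<bar> = q ^ j * \<bar>cos (real (n + j) * (t - s) - g) - cos (real (n + j) * t - (g + real n * s))\<bar>"
      using q by (simp add: right_diff_distrib[symmetric] abs_mult)
    also have "\<dots> \<le> q ^ j * \<bar>(real (n + j) * (t - s) - g) - (real (n + j) * t - (g + real n * s))\<bar>"
      using q by (intro mult_left_mono abs_cos_diff_le) auto
    also have "(real (n + j) * (t - s) - g) - (real (n + j) * t - (g + real n * s)) = - (real j * s)"
      by (simp add: algebra_simps)
    finally show ?thesis by (simp add: abs_mult mult_ac)
  qed
  note sm = summable_mult[OF geometric_deriv_suminf_le(1)[OF q], of "\<bar>s\<bar>"]
  have sd: "summable (\<lambda>j. \<bar>?d j\<bar>)"
    by (rule summable_comparison_test'[OF sm, of 0]) (use b in auto)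
  have "\<bar>cos_series (\<lambda>j. q ^ j) n g (t - s) - cos_series (\<lambda>j. q ^ j) n (g + real n * s) t\<bar> = \<bar>\<Sum>j. ?d j\<bar>"
    unfolding cos_series_def
    by (subst suminf_diff[OF cos_series_summable(2)[OF gs] cos_series_summable(2)[OF gs]]) simp
  also have "\<dots> \<le> (\<Sum>j. \<bar>?d j\<bar>)" by (rule summable_rabs[OF sd])
  also have "\<dots> \<le> (\<Sum>j. \<bar>s\<bar> * (real j * q ^ j))" by (rule suminf_le[OF b sd sm])
  also have "\<dots> = \<bar>s\<bar> * (\<Sum>j. real j * q ^ j)"
    by (rule suminf_mult[OF geometric_deriv_suminf_le(1)[OF q]])
  also have "\<dots> \<le> \<bar>s\<bar> * (1 / (1 - q)\<^sup>2)"
    by (intro mult_left_mono geometric_deriv_suminf_le(2)[OF q]) auto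
  finally show ?thesis by simp
qed

text \<open>After division by \<open>n powr - r\<close>, the \<open>j\<close>-th difference compares
  \<open>(1 + y) powr - r\<close> with \<open>exp (- (r * y))\<close> at \<open>y = j / n\<close>.
  Two majorants cover \<open>r \<ge> 4\<close> and \<open>r < 4\<close>; the constant comes from the
  first, \<open>16 * (2 + 4) = 96\<close>.\<close>

lemma weyl_coeff_geometric_close:
  fixes r :: real
  assumes n: "n \<ge> 1" and r: "2 \<le> r" "r \<le> real n + 1"
  defines "q \<equiv> exp (- (r / real n))"
  shows "summable (\<lambda>j. \<bar>weyl_coeff r n j - real n powr (- r) * q ^ j\<bar>) \<and>
    (\<Sum>j. \<bar>weyl_coeff r n j - real n powr (- r) * q ^ j\<bar>) \<le> real n powr (- r) * (96 * (real n / r\<^sup>2))"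
proof -
  define N where "N = real n powr (- r)"
  have N: "N \<ge> 0" by (simp add: N_def)
  have n0: "real n > 0" using n by simp
  let ?d = "\<lambda>j. \<bar>weyl_coeff r n j - N * q ^ j\<bar>"
  define e where "e = (\<lambda>j. (1 + real j / real n) powr (- r) - exp (- (r * (real j / real n))))"
  have e0: "e j \<ge> 0" for j
    using powr_minus_exp_bounds(1)[of "real j / real n" r] r by (simp add: e_def)
  have d: "?d j = N * e j" for j
  proof -
    have "real (n + j) = real n * (1 + real j / real n)" using n0 by (simp add: field_simps)
    then have "weyl_coeff r n j = N * (1 + real j / real n) powr (- r)"
      using n0 by (simp add: N_def powr_mult)
    moreover have "q ^ j = exp (- (r * (real j / real n)))"
      by (simp add: q_def exp_of_nat_mult[symmetric] mult_ac)
    ultimately have "weyl_coeff r n j - N * q ^ j = N * e j" by (simp add: e_def algebra_simps)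
    then show ?thesis using N e0[of j] by simp
  qed
  \<comment> \<open>Both ranges of \<open>r\<close> supply a majorant of this one shape, with their
    own \<open>c\<close> and \<open>s\<close>.\<close>
  have main: ?thesis if s: "s > 0" and c: "c \<ge> 0" and b: "\<And>j. e j \<le> c * (1 / (1 + s * real j)\<^sup>2)"
    and cs: "c * (1 + 1 / s) \<le> 96 * (real n / r\<^sup>2)" for s c
  proof (rule conjI)
    have db: "?d j \<le> N * c * (1 / (1 + s * real j)\<^sup>2)" for j
      unfolding d using mult_left_mono[OF b N, of j] by (simp add: mult.assoc)
    note sm = summable_mult[OF inverse_square_suminf_le(1)[OF s], of "N * c"]
    show sd: "summable (\<lambda>j. \<bar>weyl_coeff r n j - real n powr (- r) * q ^ j\<bar>)"
      unfolding N_def[symmetric] by (rule summable_comparison_test'[OF sm, of 0]) (use db in auto)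
    have "(\<Sum>j. ?d j) \<le> (\<Sum>j. N * c * (1 / (1 + s * real j)\<^sup>2))"
      by (rule suminf_le[OF db sd[folded N_def] sm])
    also have "\<dots> = N * c * (\<Sum>j. 1 / (1 + s * real j)\<^sup>2)"
      by (rule suminf_mult[OF inverse_square_suminf_le(1)[OF s]])
    also have "\<dots> \<le> N * c * (1 + 1 / s)"
      using N c by (intro mult_left_mono inverse_square_suminf_le s) auto
    also have "\<dots> \<le> N * (96 * (real n / r\<^sup>2))"
      using mult_left_mono[OF cs N] by (simp only: mult.assoc)
    finally show "(\<Sum>j. \<bar>weyl_coeff r n j - real n powr (- r) * q ^ j\<bar>)
        \<le> real n powr (- r) * (96 * (real n / r\<^sup>2))" by (simp add: N_def)
  qed
  show ?thesis
  proof (cases "r \<ge> 4")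
    case True
    show ?thesis
    proof (rule main[of "r / (4 * real n)" "16 / r"])
      show "e j \<le> 16 / r * (1 / (1 + r / (4 * real n) * real j)\<^sup>2)" for j
        using powr_minus_exp_le_inverse_square[of "real j / real n" r] True by (simp add: e_def)
      \<comment> \<open>From \<open>r \<le> n + 1 \<le> 2 * n\<close>; it lets the first term of the
        series be counted on the scale \<open>n / r\<close>.\<close>
      have "1 \<le> 2 * real n / r" using r n True by (simp add: field_simps)
      then have "16 / r * (1 + 1 / (r / (4 * real n))) \<le> 16 / r * (2 * real n / r + 4 * real n / r)"
        using r by (intro mult_left_mono add_mono) auto
      also have "\<dots> = 96 * (real n / r\<^sup>2)" by (simp add: power2_eq_square)
      finally show "16 / r * (1 + 1 / (r / (4 * real n))) \<le> 96 * (real n / r\<^sup>2)" .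
    qed (use r n0 in auto)
  next
    case False
    show ?thesis
    proof (rule main[of "1 / real n" 1])
      show "e j \<le> 1 * (1 / (1 + 1 / real n * real j)\<^sup>2)" for j
        using powr_minus_exp_le_inverse_square'[of "real j / real n" r] r by (simp add: e_def)
      have "r\<^sup>2 \<le> 4\<^sup>2" using False r by (intro power_mono) auto
      then have "2 * r\<^sup>2 * real n \<le> 96 * real n" using n0 by (intro mult_right_mono) auto
      then have "2 * real n \<le> 96 * (real n / r\<^sup>2)" using r by (simp add: field_simps)
      then show "1 * (1 + 1 / (1 / real n)) \<le> 96 * (real n / r\<^sup>2)" using n by simp
    qed (use n0 in auto)
  qed
qed

subsection \<open>The geometric kernel\<close>

definition geom_amp :: "real \<Rightarrow> real \<Rightarrow> real" where
  "geom_amp q t = 1 / cmod (1 - of_real q * cis t)"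

lemma geom_den_nonzero:
  assumes "0 \<le> q" "q < (1::real)"
  shows "1 - of_real q * cis t \<noteq> 0"
proof
  assume "1 - of_real q * cis t = 0"
  then have "cmod (of_real q * cis t) = 1" by simp
  then show False using assms by (simp add: norm_mult)
qed

text \<open>The series is the real part of \<open>cis (- g) * Z\<close> with
  \<open>Z = cis (n * t) / (1 - q * cis t)\<close>. In the polar form of \<open>Z\<close> the
  amplitude is free of \<open>n\<close> and \<open>g\<close>, which enter the phase only.\<close>

lemma geometric_cos_series_closed:
  assumes q: "0 \<le> q" "q < (1::real)"
  shows "cos_series (\<lambda>j. q ^ j) n g t = geom_amp q t * cos (Arg (cis (real n * t) / (1 - of_real q * cis t)) - g)"
proof -
  define z where "z = of_real q * cis t"
  define Z where "Z = cis (real n * t) / (1 - z)"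
  have nz: "norm z < 1" using q by (simp add: z_def norm_mult)
  have "(\<lambda>j. z ^ j) sums (1 / (1 - z))" by (rule geometric_sums[OF nz])
  from sums_Re[OF sums_mult[OF this, of "cis (real n * t - g)"]]
  have "(\<lambda>j. Re (cis (real n * t - g) * z ^ j)) sums Re (cis (real n * t - g) * (1 / (1 - z)))" .
  moreover have "Re (cis (real n * t - g) * z ^ j) = q ^ j * cos (real (n + j) * t - g)" for j
  proof -
    have "cis (real n * t - g) * z ^ j = of_real (q ^ j) * cis (real (n + j) * t - g)"
      unfolding z_def power_mult_distrib Complex.DeMoivre
      by (simp add: Complex.DeMoivre cis_mult algebra_simps)
    then show ?thesis by simp
  qed
  ultimately have "cos_series (\<lambda>j. q ^ j) n g t = Re (cis (real n * t - g) * (1 / (1 - z)))"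
    unfolding cos_series_def by (simp add: sums_iff)
  also have "cis (real n * t - g) * (1 / (1 - z)) = cis (- g) * Z"
  proof -
    have "cis (real n * t - g) = cis (- g) * cis (real n * t)" by (simp add: cis_mult)
    then show ?thesis by (simp add: Z_def)
  qed
  also have "Z = rcis (norm Z) (Arg Z)" by (simp add: rcis_cmod_Arg)
  also have "Re (cis (- g) * rcis (norm Z) (Arg Z)) = norm Z * cos (Arg Z - g)"
    by (simp add: rcis_def cos_diff algebra_simps)
  also have "norm Z = geom_amp q t" by (simp add: Z_def geom_amp_def z_def norm_divide)
  finally show ?thesis by (simp add: Z_def z_def)
qed

lemma geom_amp_continuous:
  assumes "0 \<le> q" "q < 1"
  shows "continuous_on A (geom_amp q)"
  unfolding geom_amp_def using geom_den_nonzero[OF assms]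
  by (intro continuous_intros) auto

lemma geom_amp_pos:
  assumes "0 \<le> q" "q < 1"
  shows "geom_amp q t > 0"
  using geom_den_nonzero[OF assms] by (simp add: geom_amp_def)

section \<open>The binomial series and Parseval's identity for powers of the amplitude\<close>

definition binom_coeff :: "real \<Rightarrow> real \<Rightarrow> nat \<Rightarrow> real" where
  "binom_coeff a q k = pochhammer a k / fact k * q ^ k"

text \<open>The generalised binomial series at \<open>- q * cis t\<close>; the signs from the
  binomial coefficient and from the power cancel.\<close>

lemma binom_coeff_sums:
  assumes q: "0 \<le> q" "q < (1::real)"
  shows "(\<lambda>k. of_real (binom_coeff a q k) * cis (real k * t)) sums (1 - of_real q * cis t) powr (- of_real a)"
proof -
  define z where "z = - (of_real q * cis t)"
  have "norm z < 1" using q by (simp add: z_def norm_mult)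
  from gen_binomial_complex[OF this, of "- of_real a"]
  have "(\<lambda>k. (- of_real a gchoose k) * z ^ k) sums (1 + z) powr (- of_real a)" .
  moreover have "(- of_real a gchoose k) * z ^ k = of_real (binom_coeff a q k) * cis (real k * t)" for k
  proof -
    have "(- of_real a gchoose k) = (- 1) ^ k * (of_real (pochhammer a k / fact k) :: complex)"
      by (simp add: gbinomial_pochhammer pochhammer_of_real)
    moreover have "z ^ k = (- 1) ^ k * (of_real (q ^ k) * cis (real k * t))"
      unfolding z_def power_minus[of "of_real q * cis t"] power_mult_distrib by (simp add: Complex.DeMoivre)
    moreover have "(- 1) ^ k * (- 1) ^ k = (1 :: complex)" by (simp add: power_mult_distrib[symmetric])
    ultimately show ?thesis by (simp add: binom_coeff_def)
  qed
  ultimately show ?thesis by (simp add: z_def)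
qed

lemma binom_coeff_nonneg:
  assumes "a \<ge> 0" "q \<ge> 0"
  shows "binom_coeff a q k \<ge> 0"
  using assms unfolding binom_coeff_def pochhammer_prod
  by (intro mult_nonneg_nonneg divide_nonneg_nonneg prod_nonneg) auto

lemma binom_coeff_summable:
  assumes q: "0 \<le> q" "q < (1::real)" and a: "a \<ge> 0"
  shows "summable (\<lambda>k. \<bar>binom_coeff a q k\<bar>)"
proof -
  \<comment> \<open>At \<open>t = 0\<close> the series has nonnegative terms, so its convergence is
    absolute convergence.\<close>
  have "summable (\<lambda>k. Re (of_real (binom_coeff a q k) * cis (real k * 0)))"
    using sums_Re[OF binom_coeff_sums[OF q, of a 0]] by (rule sums_summable)
  then show ?thesis using binom_coeff_nonneg[OF a q(1)] by simp
qed

text \<open>For a real exponent the modulus of a complex power is the power of the modulus. Hence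
  the left side is the squared modulus of \<open>(1 - q * cis t) powr (- a)\<close>, split into real
  and imaginary parts in preparation for Parseval; it is used with \<open>a = p / 2\<close>.\<close>

lemma geom_amp_powr_series:
  assumes q: "0 \<le> q" "q < (1::real)" and a: "a \<ge> 0"
  shows "geom_amp q t powr (2 * a) = (\<Sum>k. binom_coeff a q k * cos (real k * t))\<^sup>2
     + (\<Sum>k. binom_coeff a q k * sin (real k * t))\<^sup>2"
proof -
  define W where "W = (1 - of_real q * cis t) powr (- of_real a)"
  note s = binom_coeff_sums[OF q, of a t, folded W_def]
  have "Re W = (\<Sum>k. binom_coeff a q k * cos (real k * t))"
    using sums_unique[OF sums_Re[OF s]] by simp
  moreover have "Im W = (\<Sum>k. binom_coeff a q k * sin (real k * t))"
    using sums_unique[OF sums_Im[OF s]] by simp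
  moreover have "geom_amp q t powr (2 * a) = (cmod W)\<^sup>2"
  proof -
    have "cmod W = cmod (1 - of_real q * cis t) powr (- a)"
      unfolding W_def by (subst norm_powr_real_powr') auto
    also have "\<dots> = geom_amp q t powr a"
      by (simp add: geom_amp_def powr_minus powr_divide inverse_eq_divide)
    finally show ?thesis using geom_amp_pos[OF q, of t]
      by (simp add: power2_eq_square powr_add[symmetric])
  qed
  ultimately show ?thesis by (simp add: cmod_power2)
qed

text \<open>For \<open>c = 1\<close> the denominators \<open>pochhammer 1 k * fact k\<close> are
  squares of factorials, so the hypergeometric terms are squares of the binomial
  coefficients.\<close>

lemma square_suminf_binom_coeff:
  assumes q: "0 \<le> q" "q < (1::real)" and a: "a \<ge> 0"
  shows "summable (\<lambda>k. (binom_coeff a q k)\<^sup>2)"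
    and "(\<Sum>k. (binom_coeff a q k)\<^sup>2) = gauss_hypergeometric a a 1 (q\<^sup>2)"
proof -
  let ?c = "binom_coeff a q"
  note sm = binom_coeff_summable[OF q a]
  have le: "\<bar>?c k\<bar> \<le> (\<Sum>k. \<bar>?c k\<bar>)" for k
    using sum_le_suminf[OF sm, of "{k}"] by simp
  show s2: "summable (\<lambda>k. (?c k)\<^sup>2)"
  proof (rule summable_comparison_test'[OF summable_mult[OF sm, of "\<Sum>k. \<bar>?c k\<bar>"], of 0])
    fix k
    have "(?c k)\<^sup>2 = \<bar>?c k\<bar> * \<bar>?c k\<bar>" by (simp add: power2_eq_square)
    also have "\<dots> \<le> (\<Sum>k. \<bar>?c k\<bar>) * \<bar>?c k\<bar>" by (intro mult_right_mono le) auto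
    finally show "norm ((?c k)\<^sup>2) \<le> (\<Sum>k. \<bar>?c k\<bar>) * \<bar>?c k\<bar>" by simp
  qed
  have "pochhammer a (Suc k) * pochhammer a (Suc k) / pochhammer 1 (Suc k) * ((q\<^sup>2) ^ Suc k / fact (Suc k)) = (?c (Suc k))\<^sup>2" for k
    unfolding binom_coeff_def pochhammer_fact[symmetric] power2_eq_square power_mult_distrib
    by (simp only: times_divide_eq_left times_divide_eq_right divide_divide_eq_left mult_ac)
  then have "gauss_hypergeometric a a 1 (q\<^sup>2) = (?c 0)\<^sup>2 + (\<Sum>k. (?c (Suc k))\<^sup>2)"
    unfolding gauss_hypergeometric_def by (simp add: binom_coeff_def)
  then show "(\<Sum>k. (?c k)\<^sup>2) = gauss_hypergeometric a a 1 (q\<^sup>2)"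
    using suminf_split_head[OF s2] by simp
qed

text \<open>Parseval's identity for the cosine and the sine part: one factor is expanded, and its
  integrals against the other yield the same coefficients again. The weights \<open>2 * pi\<close>,
  \<open>pi\<close> and \<open>0\<close>, \<open>pi\<close> add up to \<open>2 * pi\<close> at every
  index.\<close>

lemma geom_amp_powr_integral:
  assumes q: "0 \<le> q" "q < (1::real)" and a: "a \<ge> 0"
  shows "(LINT t|per_measure. geom_amp q t powr (2 * a)) = 2 * pi * gauss_hypergeometric a a 1 (q\<^sup>2)"
proof -
  let ?c = "binom_coeff a q"
  define U where "U = (\<lambda>t. \<Sum>k. ?c k * cos (real k * t))"
  define V where "V = (\<lambda>t. \<Sum>k. ?c k * sin (real k * t))"
  note sm = binom_coeff_summable[OF q a]
  have z: "summable (\<lambda>k::nat. \<bar>0::real\<bar>)" by simp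
  have Uc: "continuous_on UNIV U"
    using cos_series_continuous[OF sm, of UNIV 0 0] by (simp add: cos_series_def U_def[abs_def])
  have Vc: "continuous_on UNIV V"
    using cos_series_continuous[OF sm, of UNIV 0 "pi / 2"]
    by (simp add: cos_series_def V_def[abs_def] cos_diff)
  have UU: "(\<lambda>k. (if k = 0 then 2 * pi else pi) * (?c k)\<^sup>2) sums (LINT t|per_measure. U t * U t)"
  proof -
    have "(\<lambda>k. LINT t|per_measure. ?c k * cos (real k * t) * U t) sums (LINT t|per_measure. U t * U t)"
      unfolding U_def
      by (rule integral_termwise[OF integrable_per_continuous[OF Uc[unfolded U_def]] _ _ sm])
         (auto intro!: lebesgue_imp_per_measurable continuous_imp_lebesgue_measurable continuous_intros
           mult_left_le simp: abs_mult)
    moreover have "(LINT t|per_measure. ?c k * cos (real k * t) * U t) = (if k = 0 then 2 * pi else pi) * (?c k)\<^sup>2" for k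
      using trig_series_coeffs(1)[OF sm z, of k]
      by (simp add: U_def mult.assoc mult.commute[of "cos _"] power2_eq_square)
    ultimately show ?thesis by simp
  qed
  have VV: "(\<lambda>k. (if k = 0 then 0 else pi) * (?c k)\<^sup>2) sums (LINT t|per_measure. V t * V t)"
  proof -
    have "(\<lambda>k. LINT t|per_measure. ?c k * sin (real k * t) * V t) sums (LINT t|per_measure. V t * V t)"
      unfolding V_def
      by (rule integral_termwise[OF integrable_per_continuous[OF Vc[unfolded V_def]] _ _ sm])
         (auto intro!: lebesgue_imp_per_measurable continuous_imp_lebesgue_measurable continuous_intros
           mult_left_le simp: abs_mult)
    moreover have "(LINT t|per_measure. ?c k * sin (real k * t) * V t) = (if k = 0 then 0 else pi) * (?c k)\<^sup>2" for k
      using trig_series_coeffs(2)[OF z sm, of k]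
      by (simp add: V_def mult.assoc mult.commute[of "sin _"] power2_eq_square)
    ultimately show ?thesis by simp
  qed
  have "(LINT t|per_measure. geom_amp q t powr (2 * a)) = (LINT t|per_measure. U t * U t + V t * V t)"
    unfolding geom_amp_powr_series[OF q a] U_def V_def power2_eq_square ..
  also have "\<dots> = (LINT t|per_measure. U t * U t) + (LINT t|per_measure. V t * V t)"
    using Uc Vc by (intro Bochner_Integration.integral_add integrable_per_continuous continuous_intros)
  also have "\<dots> = (\<Sum>k. 2 * pi * (?c k)\<^sup>2)"
  proof -
    have "(\<lambda>k. 2 * pi * (?c k)\<^sup>2) sums ((LINT t|per_measure. U t * U t) + (LINT t|per_measure. V t * V t))"
      using sums_add[OF UU VV] by (rule sums_cong[THEN iffD1, rotated]) (simp add: algebra_simps)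
    then show ?thesis by (rule sums_unique)
  qed
  also have "\<dots> = 2 * pi * gauss_hypergeometric a a 1 (q\<^sup>2)"
    using square_suminf_binom_coeff[OF q a] by (simp add: suminf_mult)
  finally show ?thesis .
qed

subsection \<open>Norms of the geometric kernel\<close>

lemma p_norm_continuous:
  assumes f: "continuous_on UNIV f" and p: "p \<ge> 1"
  shows "(\<integral>\<^sup>+ t. ennreal (\<bar>f t\<bar> powr p) \<partial>per_measure) = ennreal (LINT t|per_measure. \<bar>f t\<bar> powr p)"
    and "p_norm (ereal p) f = ereal ((LINT t|per_measure. \<bar>f t\<bar> powr p) powr (1 / p))"
proof -
  have i: "integrable per_measure (\<lambda>t. \<bar>f t\<bar> powr p)"
    using f p by (intro integrable_per_continuous continuous_intros continuous_on_powr') auto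
  show 1: "(\<integral>\<^sup>+ t. ennreal (\<bar>f t\<bar> powr p) \<partial>per_measure) = ennreal (LINT t|per_measure. \<bar>f t\<bar> powr p)"
    by (rule nn_integral_eq_integral[OF i]) auto
  show "p_norm (ereal p) f = ereal ((LINT t|per_measure. \<bar>f t\<bar> powr p) powr (1 / p))"
    using p 1 by (intro p_norm_finite_eq) (auto intro: Bochner_Integration.integral_nonneg)
qed

lemma p_norm_shift:
  assumes f: "continuous_on UNIV f" and per: "\<And>t. f (t + 2 * pi) = f t"
  shows "p_norm (ereal p) (\<lambda>t. f (t - a)) = p_norm (ereal p) f"
proof -
  have [measurable]: "f \<in> borel_measurable lebesgue" using f by (rule continuous_imp_lebesgue_measurable)
  have "(\<integral>\<^sup>+ t. ennreal (\<bar>f (t - a)\<bar> powr p) \<partial>per_measure) = (\<integral>\<^sup>+ t. ennreal (\<bar>f t\<bar> powr p) \<partial>per_measure)"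
    using nn_integral_period_shift[of "\<lambda>t. ennreal (\<bar>f t\<bar> powr p)" "- a"] per by simp
  then show ?thesis by (simp add: p_norm_def)
qed

text \<open>For continuous \<open>f\<close> the points of the open period where
  \<open>\<bar>f\<bar>\<close> exceeds an essential bound form an open null set, which is empty; the
  endpoints follow by closure.\<close>

lemma abs_le_esssup:
  assumes f: "continuous_on UNIV f" and t0: "t0 \<in> {-pi..pi}"
  shows "ereal \<bar>f t0\<bar> \<le> esssup per_measure (\<lambda>t. ereal \<bar>f t\<bar>)"
proof (rule ccontr)
  define N where "N = esssup per_measure (\<lambda>t. ereal \<bar>f t\<bar>)"
  assume "\<not> ?thesis"
  then have N: "N < ereal \<bar>f t0\<bar>" by (simp add: N_def)
  obtain c where c: "c < \<bar>f t0\<bar>" "N \<le> ereal c"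
  proof (cases N)
    case (real c)
    then show ?thesis using N that by auto
  next
    case MInf
    then show ?thesis using that[of "\<bar>f t0\<bar> - 1"] by simp
  qed (use N in auto)
  have "AE t in per_measure. \<bar>f t\<bar> \<le> c"
    using esssup_AE[of "\<lambda>t. ereal \<bar>f t\<bar>" per_measure]
  proof eventually_elim
    case (elim t)
    then have "ereal \<bar>f t\<bar> \<le> ereal c" using c(2) unfolding N_def by (rule order_trans)
    then show ?case by simp
  qed
  then have AE: "AE t in lebesgue. t \<in> {-pi..pi} \<longrightarrow> \<bar>f t\<bar> \<le> c"
    by (simp add: AE_restrict_space_iff)
  define S where "S = {-pi<..<pi} \<inter> {t. c < \<bar>f t\<bar>}"
  have "open S" unfolding S_def
    by (intro open_Int open_Collect_less continuous_intros f)
  moreover have "S \<in> null_sets lebesgue"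
  proof (rule null_setsI)
    show S: "S \<in> sets lebesgue" using \<open>open S\<close> by (simp add: borel_open)
    have "AE t in lebesgue. t \<notin> S" using AE by eventually_elim (auto simp: S_def)
    then show "emeasure lebesgue S = 0" using S by (simp add: AE_iff_null_sets null_setsD1)
  qed
  ultimately have "S = {}" using open_not_negligible by (auto simp: negligible_iff_null_sets)
  then have le: "\<bar>f t\<bar> \<le> c" if "t \<in> {-pi<..<pi}" for t using that by (force simp: S_def)
  have "\<bar>f t0\<bar> \<le> c"
  proof (rule continuous_le_on_closure[where S = "{-pi<..<pi}" and f = "\<lambda>t. \<bar>f t\<bar>" and x = t0])
    show "continuous_on (closure {-pi<..<pi}) (\<lambda>t. \<bar>f t\<bar>)"
      by (intro continuous_intros continuous_on_subset[OF f]) auto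
    show "t0 \<in> closure {-pi<..<pi}" using t0 by (simp add: closure_greaterThanLessThan)
  qed (use le in auto)
  then show False using c by simp
qed

context
  fixes q :: real and n :: nat
  assumes q: "0 \<le> q" "q < 1" and n: "n \<ge> 1"
begin

abbreviation geom_kernel :: "real \<Rightarrow> real \<Rightarrow> real" where
  "geom_kernel \<equiv> cos_series (\<lambda>j. q ^ j) n"

lemma geom_kernel_bound: "\<bar>geom_kernel g t\<bar> \<le> 1 / (1 - q)"
proof -
  have "(\<Sum>j. \<bar>q ^ j\<bar>) = 1 / (1 - q)" using q by (simp add: suminf_geometric power_abs[symmetric])
  then show ?thesis using cos_series_bound[OF geometric_abs_summable[OF q], of n g t] by simp
qed

lemma geom_kernel_continuous: "continuous_on A (geom_kernel g)"
  by (rule cos_series_continuous[OF geometric_abs_summable[OF q]])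

lemma geom_kernel_measurable: "geom_kernel g \<in> borel_measurable per_measure"
  by (intro lebesgue_imp_per_measurable continuous_imp_lebesgue_measurable geom_kernel_continuous)

text \<open>Separates the phase shift from \<open>t\<close>. This yields joint measurability in both
  variables and, at \<open>h = pi\<close>, the change of sign of the kernel.\<close>

lemma geom_kernel_phase:
  "geom_kernel (g + h) t = cos h * geom_kernel g t + sin h * geom_kernel (g + pi / 2) t"
  unfolding geometric_cos_series_closed[OF q]
  by (simp add: cos_diff sin_add cos_add cos_diff algebra_simps)

text \<open>The sum \<open>1 / (1 - q)\<close> of the coefficients bounds the kernel. It is nearly
  attained where \<open>n * t\<close> is congruent to \<open>g\<close>: up to the translation error
  all cosines there equal 1.\<close>

lemma p_norm_geom_kernel_infinity:
  "\<exists>N. p_norm \<infinity> (geom_kernel g) = ereal N \<and> \<bar>N - 1 / (1 - q)\<bar> \<le> 2 * pi * (pi / real n / (1 - q)\<^sup>2)"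
proof -
  define D where "D = pi / real n / (1 - q)\<^sup>2"
  define k where "k = \<lfloor>(g + pi) / (2 * pi)\<rfloor>"
  \<comment> \<open>Reducing \<open>g\<close> modulo \<open>2 * pi\<close> first keeps
    \<open>t\<close> within \<open>pi / n\<close>, so that the translation error stays
    small.\<close>
  define t where "t = (g - 2 * pi * of_int k) / real n"
  have "of_int k \<le> (g + pi) / (2 * pi)" "(g + pi) / (2 * pi) < of_int k + 1"
    unfolding k_def by linarith+
  then have gk: "\<bar>g - 2 * pi * of_int k\<bar> \<le> pi" by (simp add: field_simps abs_le_iff)
  have tn: "\<bar>t\<bar> \<le> pi / real n" unfolding t_def abs_divide using gk n by (simp add: divide_right_mono)
  also have "\<dots> \<le> pi / 1" using n by (intro divide_left_mono) auto
  finally have t: "t \<in> {-pi..pi}" by auto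
  have "geom_kernel (g + real n * (- t)) 0 = (\<Sum>j. q ^ j)"
  proof -
    have "g + real n * (- t) = 0 + 2 * pi * of_int k" using n by (simp add: t_def)
    moreover have "cos (0 - (0 + 2 * pi * of_int k)) = 1"
      using period_int[of cos 0 k, OF cos_periodic] by simp
    ultimately show ?thesis by (simp add: cos_series_def)
  qed
  also have "\<dots> = 1 / (1 - q)" using q by (simp add: suminf_geometric)
  finally have "\<bar>geom_kernel g t - 1 / (1 - q)\<bar> \<le> \<bar>t\<bar> / (1 - q)\<^sup>2"
    using geometric_cos_series_shift[OF q, of n g 0 "- t"] by simp
  also have "\<dots> \<le> D" unfolding D_def using tn by (intro divide_right_mono) auto
  finally have lo: "1 / (1 - q) - D \<le> \<bar>geom_kernel g t\<bar>" by linarith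
  define E where "E = p_norm \<infinity> (geom_kernel g)"
  have "E \<le> ereal (1 / (1 - q))"
    unfolding E_def p_norm_def using geom_kernel_bound geom_kernel_measurable by auto
  moreover have "ereal (1 / (1 - q) - D) \<le> E"
    using order_trans[OF _ abs_le_esssup[OF geom_kernel_continuous t]] lo
    by (simp add: E_def p_norm_def)
  ultimately obtain N where N: "E = ereal N" "N \<le> 1 / (1 - q)" "1 / (1 - q) - D \<le> N"
    by (cases E) auto
  have "D \<ge> 0" unfolding D_def by simp
  \<comment> \<open>The factor \<open>2 * pi\<close> brings the bound to the form obtained for
    finite exponents.\<close>
  then have "1 * D \<le> 2 * pi * D" using pi_ge_two by (intro mult_right_mono) auto
  then have "\<bar>N - 1 / (1 - q)\<bar> \<le> 2 * pi * D" using N \<open>D \<ge> 0\<close> unfolding abs_le_iff by linarith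
  then show ?thesis using N(1) unfolding D_def E_def by blast
qed

text \<open>A phase change by \<open>h\<close> is nearly a translation by \<open>h / n\<close>, and
  translations preserve the norm.\<close>

lemma p_norm_geom_kernel_phase:
  assumes p: "p \<ge> 1" and h: "\<bar>h\<bar> \<le> pi"
  shows "p_norm (ereal p) (geom_kernel (g + h)) \<le> p_norm (ereal p) (geom_kernel g) + ereal (2 * pi * (pi / real n / (1 - q)\<^sup>2))"
    and "p_norm (ereal p) (geom_kernel g) \<le> p_norm (ereal p) (geom_kernel (g + h)) + ereal (2 * pi * (pi / real n / (1 - q)\<^sup>2))"
proof -
  define s where "s = h / real n"
  define D where "D = pi / real n / (1 - q)\<^sup>2"
  have D: "D \<ge> 0" by (simp add: D_def)
  have p': "1 \<le> ereal p" using p by (simp add: one_ereal_def)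
  have sm: "(\<lambda>t. geom_kernel g (t - s)) \<in> borel_measurable per_measure"
    by (intro lebesgue_imp_per_measurable continuous_imp_lebesgue_measurable
        continuous_on_compose2[OF geom_kernel_continuous] continuous_intros) auto
  have close: "\<bar>geom_kernel g (t - s) - geom_kernel (g + h) t\<bar> \<le> D" for t
  proof -
    have "\<bar>geom_kernel g (t - s) - geom_kernel (g + h) t\<bar> \<le> \<bar>s\<bar> / (1 - q)\<^sup>2"
      using geometric_cos_series_shift[OF q, of n g t s] n by (simp add: s_def)
    also have "\<dots> \<le> D" unfolding D_def s_def abs_divide
      using h n by (intro divide_right_mono) (auto simp: divide_right_mono)
    finally show ?thesis .
  qed
  have sh: "p_norm (ereal p) (\<lambda>t. geom_kernel g (t - s)) = p_norm (ereal p) (geom_kernel g)"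
    by (rule p_norm_shift[OF geom_kernel_continuous cos_series_periodic])
  show "p_norm (ereal p) (geom_kernel (g + h)) \<le> p_norm (ereal p) (geom_kernel g) + ereal (2 * pi * (pi / real n / (1 - q)\<^sup>2))"
    unfolding sh[symmetric] D_def[symmetric]
  proof (rule p_norm_le_add[OF p' geom_kernel_measurable sm D])
    show "\<bar>geom_kernel (g + h) t\<bar> \<le> \<bar>geom_kernel g (t - s)\<bar> + D" for t using close[of t] by linarith
  qed
  show "p_norm (ereal p) (geom_kernel g) \<le> p_norm (ereal p) (geom_kernel (g + h)) + ereal (2 * pi * (pi / real n / (1 - q)\<^sup>2))"
    unfolding sh[symmetric] D_def[symmetric]
  proof (rule p_norm_le_add[OF p' sm geom_kernel_measurable D])
    show "\<bar>geom_kernel g (t - s)\<bar> \<le> \<bar>geom_kernel (g + h) t\<bar> + D" for t using close[of t] by linarith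
  qed
qed

text \<open>The phase of the kernel disappears on integrating over \<open>h\<close>, as \<open>cos\<close> is integrated over a full period.\<close>

lemma geom_kernel_phase_average:
  assumes p: "p \<ge> 1"
  shows "(\<integral>\<^sup>+ h. (\<integral>\<^sup>+ t. ennreal (\<bar>geom_kernel (g + h) t\<bar> powr p) \<partial>per_measure) \<partial>per_measure) =
    ennreal (2 * pi * gauss_hypergeometric (p / 2) (p / 2) 1 (q\<^sup>2) * (LINT t|per_measure. \<bar>cos t\<bar> powr p))"
proof -
  define J where "J = (LINT t|per_measure. \<bar>cos t\<bar> powr p)"
  have Jeq: "(\<integral>\<^sup>+ t. ennreal (\<bar>cos t\<bar> powr p) \<partial>per_measure) = ennreal J"
    unfolding J_def by (rule p_norm_continuous(1)[OF _ p]) (intro continuous_intros)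
  have J0: "J \<ge> 0" unfolding J_def by (intro Bochner_Integration.integral_nonneg) auto
  have cosm[measurable]: "(cos :: real \<Rightarrow> real) \<in> borel_measurable lebesgue"
    by (intro continuous_imp_lebesgue_measurable continuous_intros)
  have ac: "continuous_on UNIV (geom_amp q)" using q by (rule geom_amp_continuous)
  \<comment> \<open>The phase formula leaves only products of continuous functions of one coordinate
    each.\<close>
  have meas: "(\<lambda>(h, t). ennreal (\<bar>geom_kernel (g + h) t\<bar> powr p)) \<in> borel_measurable (per_measure \<Otimes>\<^sub>M per_measure)"
  proof -
    have comp: "(\<lambda>x. f (fst x)) \<in> borel_measurable (per_measure \<Otimes>\<^sub>M per_measure)"
      "(\<lambda>x. f (snd x)) \<in> borel_measurable (per_measure \<Otimes>\<^sub>M per_measure)"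
      if "continuous_on UNIV f" for f :: "real \<Rightarrow> real"
      using measurable_compose[OF measurable_fst lebesgue_imp_per_measurable[OF continuous_imp_lebesgue_measurable[OF that]]]
        measurable_compose[OF measurable_snd lebesgue_imp_per_measurable[OF continuous_imp_lebesgue_measurable[OF that]]]
      by auto
    have [measurable]: "(\<lambda>x. cos (fst x)) \<in> borel_measurable (per_measure \<Otimes>\<^sub>M per_measure)"
      "(\<lambda>x. sin (fst x)) \<in> borel_measurable (per_measure \<Otimes>\<^sub>M per_measure)"
      "(\<lambda>x. geom_kernel g (snd x)) \<in> borel_measurable (per_measure \<Otimes>\<^sub>M per_measure)"
      "(\<lambda>x. geom_kernel (g + pi / 2) (snd x)) \<in> borel_measurable (per_measure \<Otimes>\<^sub>M per_measure)"
      by (rule comp; intro continuous_intros geom_kernel_continuous)+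
    have eq: "(\<lambda>(h, t). ennreal (\<bar>geom_kernel (g + h) t\<bar> powr p)) = (\<lambda>x. ennreal
        (\<bar>cos (fst x) * geom_kernel g (snd x) + sin (fst x) * geom_kernel (g + pi / 2) (snd x)\<bar> powr p))"
    proof
      fix x :: "real \<times> real"
      show "(case x of (h, t) \<Rightarrow> ennreal (\<bar>geom_kernel (g + h) t\<bar> powr p)) = ennreal
        (\<bar>cos (fst x) * geom_kernel g (snd x) + sin (fst x) * geom_kernel (g + pi / 2) (snd x)\<bar> powr p)"
        by (simp only: case_prod_unfold geom_kernel_phase[of g "fst x"])
    qed
    show ?thesis unfolding eq by measurable
  qed
  have "(\<integral>\<^sup>+ h. (\<integral>\<^sup>+ t. ennreal (\<bar>geom_kernel (g + h) t\<bar> powr p) \<partial>per_measure) \<partial>per_measure) =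
      (\<integral>\<^sup>+ t. (\<integral>\<^sup>+ h. ennreal (\<bar>geom_kernel (g + h) t\<bar> powr p) \<partial>per_measure) \<partial>per_measure)"
    by (rule pair_sigma_finite.Fubini'[OF pair_sigma_finite_per_measure meas, symmetric])
  also have "\<dots> = (\<integral>\<^sup>+ t. ennreal (\<bar>geom_amp q t\<bar> powr p) * ennreal J \<partial>per_measure)"
  proof (rule nn_integral_cong)
    fix t
    define a where "a = Arg (cis (real n * t) / (1 - of_real q * cis t)) - g"
    have "geom_kernel (g + h) t = geom_amp q t * cos (a - h)" for h
      unfolding geometric_cos_series_closed[OF q] by (simp add: a_def algebra_simps)
    then have "(\<integral>\<^sup>+ h. ennreal (\<bar>geom_kernel (g + h) t\<bar> powr p) \<partial>per_measure) =
        (\<integral>\<^sup>+ h. ennreal (\<bar>geom_amp q t\<bar> powr p) * ennreal (\<bar>cos (a - h)\<bar> powr p) \<partial>per_measure)"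
      by (simp add: abs_mult powr_mult ennreal_mult')
    also have "\<dots> = ennreal (\<bar>geom_amp q t\<bar> powr p) * (\<integral>\<^sup>+ h. ennreal (\<bar>cos (a - h)\<bar> powr p) \<partial>per_measure)"
    proof (rule nn_integral_cmult)
      have [measurable]: "(\<lambda>h. cos (a - h)) \<in> borel_measurable per_measure"
        by (intro lebesgue_imp_per_measurable continuous_imp_lebesgue_measurable continuous_intros)
      show "(\<lambda>h. ennreal (\<bar>cos (a - h)\<bar> powr p)) \<in> borel_measurable per_measure" by measurable
    qed
    also have "(\<integral>\<^sup>+ h. ennreal (\<bar>cos (a - h)\<bar> powr p) \<partial>per_measure) = ennreal J"
      unfolding Jeq[symmetric]
      by (rule nn_integral_period_reflect[where h = "\<lambda>h. ennreal (\<bar>cos h\<bar> powr p)"]) auto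
    finally show "(\<integral>\<^sup>+ h. ennreal (\<bar>geom_kernel (g + h) t\<bar> powr p) \<partial>per_measure) =
        ennreal (\<bar>geom_amp q t\<bar> powr p) * ennreal J" .
  qed
  also have "\<dots> = (\<integral>\<^sup>+ t. ennreal (\<bar>geom_amp q t\<bar> powr p) \<partial>per_measure) * ennreal J"
  proof (rule nn_integral_multc)
    have [measurable]: "geom_amp q \<in> borel_measurable per_measure"
      by (intro lebesgue_imp_per_measurable continuous_imp_lebesgue_measurable ac)
    show "(\<lambda>t. ennreal (\<bar>geom_amp q t\<bar> powr p)) \<in> borel_measurable per_measure" by measurable
  qed
  also have "(\<integral>\<^sup>+ t. ennreal (\<bar>geom_amp q t\<bar> powr p) \<partial>per_measure) =
      ennreal (2 * pi * gauss_hypergeometric (p / 2) (p / 2) 1 (q\<^sup>2))"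
    using p_norm_continuous(1)[OF ac p] geom_amp_powr_integral[OF q, of "p / 2"] p geom_amp_pos[OF q]
    by (simp add: abs_of_pos)
  finally show ?thesis using J0 by (simp add: J_def ennreal_mult'')
qed

text \<open>All norms \<open>N (g + h)\<close> lie within \<open>D\<close> of \<open>N g\<close>, so
  the mean of their \<open>p\<close>-th powers, which is \<open>F * J\<close>, lies between the
  \<open>p\<close>-th powers of \<open>N g - D\<close> and \<open>N g + D\<close>. Taking roots
  gives the claim.\<close>

lemma p_norm_geom_kernel:
  assumes p: "p \<ge> 1"
  shows "\<exists>N. p_norm (ereal p) (geom_kernel g) = ereal N \<and>
    \<bar>N - real_of_ereal (p_norm (ereal p) cos) * gauss_hypergeometric (p / 2) (p / 2) 1 (q\<^sup>2) powr (1 / p)\<bar>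
      \<le> 2 * pi * (pi / real n / (1 - q)\<^sup>2)"
proof -
  define D where "D = 2 * pi * (pi / real n / (1 - q)\<^sup>2)"
  define F where "F = gauss_hypergeometric (p / 2) (p / 2) 1 (q\<^sup>2)"
  define J where "J = (LINT t|per_measure. \<bar>cos t\<bar> powr p)"
  have D0: "D \<ge> 0" by (simp add: D_def)
  have J0: "J \<ge> 0" unfolding J_def by (intro Bochner_Integration.integral_nonneg) auto
  have F0: "F \<ge> 0"
    using suminf_nonneg[OF square_suminf_binom_coeff(1)[OF q, of "p / 2"]]
      square_suminf_binom_coeff(2)[OF q, of "p / 2"] p by (simp add: F_def)
  define N where "N = (\<lambda>h. (LINT t|per_measure. \<bar>geom_kernel h t\<bar> powr p) powr (1 / p))"
  have N0: "N h \<ge> 0" for h by (simp add: N_def)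
  have pn: "p_norm (ereal p) (geom_kernel h) = ereal (N h)" for h
    unfolding N_def by (rule p_norm_continuous(2)[OF geom_kernel_continuous p])
  have I: "(\<integral>\<^sup>+ t. ennreal (\<bar>geom_kernel h t\<bar> powr p) \<partial>per_measure) = ennreal (N h powr p)" for h
    unfolding p_norm_continuous(1)[OF geom_kernel_continuous p] N_def using p
    by (simp add: powr_powr Bochner_Integration.integral_nonneg)
  have avg: "(\<integral>\<^sup>+ h. ennreal (N (g + h) powr p) \<partial>per_measure) = ennreal (2 * pi * (F * J))"
    using geom_kernel_phase_average[OF p, of g] by (simp add: I F_def J_def mult.assoc)
  have cmp: "N (g + h) \<le> N g + D" "N g \<le> N (g + h) + D" if "h \<in> space per_measure" for h
    using p_norm_geom_kernel_phase[OF p, of h g] that by (auto simp: pn D_def)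
  have const: "(\<integral>\<^sup>+ h. ennreal c \<partial>per_measure) = ennreal (2 * pi * c)" if "c \<ge> 0" for c
    using that by (simp add: emeasure_restrict_space ennreal_mult' mult.commute)
  have "ennreal (2 * pi * (F * J)) \<le> ennreal (2 * pi * (N g + D) powr p)"
    unfolding avg[symmetric] const[OF powr_ge_zero, symmetric]
    using cmp N0 p by (intro nn_integral_mono ennreal_leI powr_mono2) auto
  then have up: "F * J \<le> (N g + D) powr p" by (simp add: ennreal_le_iff)
  \<comment> \<open>\<open>N g - D\<close> may be negative; truncation at 0 keeps
    \<open>powr\<close> monotone.\<close>
  have "ennreal (2 * pi * (max 0 (N g - D)) powr p) \<le> ennreal (2 * pi * (F * J))"
    unfolding avg[symmetric] const[OF powr_ge_zero, symmetric]
  proof (intro nn_integral_mono ennreal_leI powr_mono2)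
    fix h assume "h \<in> space per_measure"
    then show "max 0 (N g - D) \<le> N (g + h)" using cmp(2)[of h] N0[of "g + h"] by simp
  qed (use p in auto)
  then have lo: "(max 0 (N g - D)) powr p \<le> F * J" using F0 J0 by (simp add: ennreal_le_iff)
  define M where "M = (F * J) powr (1 / p)"
  have inv: "(x powr p) powr (1 / p) = x" if "x \<ge> 0" for x using that p by (simp add: powr_powr)
  have "M \<le> N g + D"
    using powr_mono2[of "1 / p", OF _ _ up] inv[of "N g + D"] p F0 J0 N0[of g] D0 by (simp add: M_def)
  moreover have "N g - D \<le> M"
    using powr_mono2[of "1 / p", OF _ _ lo] inv[of "max 0 (N g - D)"] p by (simp add: M_def)
  ultimately have "\<bar>N g - M\<bar> \<le> D" by linarith
  moreover have "real_of_ereal (p_norm (ereal p) cos) * F powr (1 / p) = M"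
  proof -
    have "p_norm (ereal p) cos = ereal (J powr (1 / p))"
      unfolding J_def by (rule p_norm_continuous(2)[OF _ p]) (intro continuous_intros)
    then show ?thesis using F0 J0 by (simp add: M_def powr_mult mult.commute)
  qed
  ultimately show ?thesis using pn[of g] by (auto simp: D_def F_def)
qed

end

subsection \<open>The asymptotic formula\<close>

text \<open>Turns the error \<open>\<bar>s\<bar> / (1 - q)\<^sup>2\<close> of a translation with
  \<open>\<bar>s\<bar> \<le> pi / n\<close> into \<open>9 * pi * n / r\<^sup>2\<close>.\<close>

lemma inverse_one_minus_exp_square_le:
  fixes r :: real
  assumes n: "n \<ge> 1" and r: "0 < r" "r \<le> real n + 1"
  shows "1 / (1 - exp (- (r / real n)))\<^sup>2 \<le> 9 * (real n / r)\<^sup>2"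
proof -
  have "r / real n \<le> 2" using r n by (simp add: divide_le_eq)
  then have a: "1 - exp (- (r / real n)) \<ge> r / real n / 3" using r n by (intro one_minus_exp_ge) auto
  have "r / real n / 3 > 0" using r n by simp
  then have "1 / (1 - exp (- (r / real n)))\<^sup>2 \<le> 1 / (r / real n / 3)\<^sup>2" using a
    by (intro divide_left_mono power_mono mult_pos_pos zero_less_power) auto
  then show ?thesis by (simp add: power_divide mult.commute)
qed

text \<open>The convolution inequality bounds the supremum from above, half the difference of two
  near point masses at distance \<open>pi / n\<close> bounds it from below; in both cases
  \<open>K\<close> is exchanged for \<open>w * P g\<close> at a uniform cost.\<close>

lemma fourier_error_geometric:
  fixes r \<beta> :: real
  assumes n: "n \<ge> 1" and r: "2 \<le> r" "r \<le> real n + 1" and s: "s \<ge> 1"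
  defines "q \<equiv> exp (- (r / real n))"
  assumes N: "p_norm s (geom_kernel q n (\<beta> * pi / 2)) = ereal N"
  obtains E where "fourier_error n (weyl_nagy_class r \<beta>) s = ereal E"
    "\<bar>E - real n powr (- r) * (N / pi)\<bar> \<le> real n powr (- r) * (400 * (real n / r\<^sup>2))"
proof -
  define g where "g = \<beta> * pi / 2"
  define w where "w = real n powr (- r)"
  define R where "R = real n / r\<^sup>2"
  define P where "P = geom_kernel q n"
  define K where "K = cos_series (weyl_coeff r n) n g"
  have r1: "r > 1" using r by simp
  have pos: "w > 0" "R > 0" using n r by (auto simp: w_def R_def)
  have q: "0 \<le> q" "q < 1" using r n by (auto simp: q_def)
  have q3: "1 / (1 - q)\<^sup>2 \<le> 9 * (real n / r)\<^sup>2"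
    unfolding q_def using n r by (intro inverse_one_minus_exp_square_le) auto
  have sh: "\<bar>P g (t - pi / real n) - P (g + pi) t\<bar> \<le> 9 * pi * R" for t
  proof -
    have "\<bar>P g (t - pi / real n) - P (g + pi) t\<bar> \<le> \<bar>pi / real n\<bar> * (1 / (1 - q)\<^sup>2)"
      using geometric_cos_series_shift[OF q, of n g t "pi / real n"] n by (simp add: P_def)
    also have "\<dots> \<le> \<bar>pi / real n\<bar> * (9 * (real n / r)\<^sup>2)" using q3 by (intro mult_left_mono) auto
    also have "\<dots> = 9 * pi * R" using n by (simp add: R_def power_divide power2_eq_square)
    finally show ?thesis .
  qed
  have anti: "P (g + pi) t = - P g t" for t
    using geom_kernel_phase[OF q n, of g pi t] by (simp add: P_def)
  have close: "\<bar>K t - w * P g t\<bar> \<le> w * (96 * R)" for t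
  proof -
    note c = weyl_coeff_geometric_close[OF n r, folded q_def w_def R_def]
    have gs: "summable (\<lambda>j. \<bar>w * q ^ j\<bar>)"
      unfolding abs_mult by (rule summable_mult[OF geometric_abs_summable[OF q]])
    have "w * P g t = cos_series (\<lambda>j. w * q ^ j) n g t"
      unfolding P_def cos_series_def mult.assoc
      by (rule suminf_mult[OF cos_series_summable(2)[OF geometric_abs_summable[OF q]], symmetric])
    then show ?thesis
      using cos_series_diff_bound[OF weyl_coeff_summable(2)[OF r1] gs conjunct1[OF c], of n g t] conjunct2[OF c]
      by (simp add: K_def)
  qed
  have Kc: "continuous_on UNIV K" unfolding K_def
    by (rule cos_series_continuous[OF weyl_coeff_summable(2)[OF r1]])
  have Kp: "K (t + 2 * pi) = K t" for t unfolding K_def by (rule cos_series_periodic)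
  have Kb: "\<bar>K t\<bar> \<le> (\<Sum>j. \<bar>weyl_coeff r n j\<bar>)" for t
    unfolding K_def by (rule cos_series_bound[OF weyl_coeff_summable(2)[OF r1]])
  have Km: "K \<in> borel_measurable per_measure"
    by (intro lebesgue_imp_per_measurable continuous_imp_lebesgue_measurable Kc)
  have Pm: "P g \<in> borel_measurable per_measure"
    unfolding P_def by (rule geom_kernel_measurable[OF q n])
  have wPm: "(\<lambda>t. w * P g t) \<in> borel_measurable per_measure" using Pm by measurable
  have wPN: "p_norm s (\<lambda>t. w * P g t) = ereal (w * N)"
    using p_norm_cmult[OF pos(1) s Pm] N by (simp add: P_def g_def)
  define G where "G = (\<lambda>\<phi> x. LINT t|per_measure. \<phi> t * K (x - t))"
  have Gm: "G \<phi> \<in> borel_measurable per_measure" if "\<phi> \<in> unit_ball_mean_zero" for \<phi>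
    unfolding G_def using that Kc by (intro convolution_measurable) (auto simp: unit_ball_mean_zero_iff)
  have G1: "p_norm s (\<lambda>x. 1 / pi * G \<phi> x) = ereal (1 / pi) * p_norm s (G \<phi>)"
    if "\<phi> \<in> unit_ball_mean_zero" for \<phi>
    by (rule p_norm_cmult[OF _ s Gm[OF that]]) simp
  have err: "fourier_error n (weyl_nagy_class r \<beta>) s =
      (SUP \<phi> \<in> unit_ball_mean_zero. p_norm s (\<lambda>x. 1 / pi * G \<phi> x))"
    unfolding G_def K_def g_def by (rule fourier_error_eq[OF r1 n])
  define E where "E = fourier_error n (weyl_nagy_class r \<beta>) s"
  \<comment> \<open>The uniform error \<open>96 * (w * R)\<close> acquires the factor
    \<open>2 * pi\<close> in the norm and is divided by \<open>pi\<close>, giving 192.\<close>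
  have up: "E \<le> ereal (w * (N / pi) + 192 * (w * R))"
    unfolding E_def err
  proof (rule SUP_least)
    fix \<phi> assume phi: "\<phi> \<in> unit_ball_mean_zero"
    have "p_norm s (G \<phi>) \<le> p_norm s K"
      unfolding G_def using phi
      by (intro p_norm_convolution_le[OF s _ _ Kc Kp Kb]) (auto simp: unit_ball_mean_zero_iff)
    also have "\<dots> \<le> p_norm s (\<lambda>t. w * P g t) + ereal (2 * pi * (w * (96 * R)))"
    proof (rule p_norm_le_add[OF s Km wPm])
      show "\<bar>K t\<bar> \<le> \<bar>w * P g t\<bar> + w * (96 * R)" for t using close[of t] by linarith
    qed (use pos in auto)
    finally have "p_norm s (G \<phi>) \<le> ereal (w * N + 2 * pi * (w * (96 * R)))" by (simp add: wPN)
    then have "ereal (1 / pi) * p_norm s (G \<phi>) \<le> ereal (1 / pi) * ereal (w * N + 2 * pi * (w * (96 * R)))"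
      by (intro ereal_mult_left_mono) auto
    also have "\<dots> = ereal (w * (N / pi) + 192 * (w * R))" by (simp add: field_simps)
    finally show "p_norm s (\<lambda>x. 1 / pi * G \<phi> x) \<le> ereal (w * (N / pi) + 192 * (w * R))"
      unfolding G1[OF phi] .
  qed
  have lo: "ereal (w * (N / pi) - 400 * (w * R)) \<le> E"
  proof -
    obtain \<phi> where phi: "\<phi> \<in> unit_ball_mean_zero"
      and app: "\<And>x. \<bar>G \<phi> x - (K x - K (x - pi / real n)) / 2\<bar> \<le> w * R"
      using unit_ball_difference_approx[OF Kc Kp Kb, of "w * R" "pi / real n"] pos
      unfolding G_def by (metis mult_pos_pos)
    \<comment> \<open>Here \<open>x\<close> and \<open>y\<close> stand for \<open>w * P g\<close> at
      \<open>t\<close> and at \<open>t - pi / n\<close>, \<open>k\<close> and \<open>l\<close> for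
      \<open>K\<close> at these points, \<open>d\<close> for \<open>G \<phi> t\<close>. As
      \<open>2 * x = (x + y) + (x - y)\<close>, the constant \<open>18 + 96 + 1\<close> would do;
      200 is a round majorant.\<close>
    have aux: "\<bar>x\<bar> \<le> \<bar>d\<bar> + 200 * z"
      if "\<bar>y + x\<bar> \<le> 36 * z" "\<bar>k - x\<bar> \<le> 96 * z" "\<bar>l - y\<bar> \<le> 96 * z" "\<bar>d - (k - l) / 2\<bar> \<le> z" "z > 0"
      for x y k l d z :: real
    proof -
      note le = that(1-4)[THEN abs_le_D1] that(1-4)[THEN abs_le_D2] abs_ge_self[of d] abs_ge_minus_self[of d]
      show ?thesis
      proof (rule abs_leI)
        show "x \<le> \<bar>d\<bar> + 200 * z" using le that(5) by (simp only: diff_divide_distrib)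
        show "- x \<le> \<bar>d\<bar> + 200 * z" using le that(5) by (simp only: diff_divide_distrib)
      qed
    qed
    have pt: "\<bar>w * P g t\<bar> \<le> \<bar>G \<phi> t\<bar> + 200 * (w * R)" for t
    proof -
      have "\<bar>w * P g (t - pi / real n) + w * P g t\<bar> \<le> w * (9 * pi * R)"
        using mult_left_mono[OF sh[of t], of w] pos
        by (simp add: anti abs_mult distrib_left[symmetric])
      also have "\<dots> \<le> w * (9 * 4 * R)"
        using pos pi_less_4 by (intro mult_left_mono mult_right_mono) auto
      finally have "\<bar>w * P g (t - pi / real n) + w * P g t\<bar> \<le> 36 * (w * R)" by simp
      moreover have eq: "w * (96 * R) = 96 * (w * R)" by simp
      ultimately show ?thesis
        using aux[OF _ close[of t, unfolded eq] close[of "t - pi / real n", unfolded eq] app[of t]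
            mult_pos_pos[OF pos]] by blast
    qed
    have "ereal (w * N) \<le> p_norm s (G \<phi>) + ereal (2 * pi * (200 * (w * R)))"
      unfolding wPN[symmetric]
      by (rule p_norm_le_add[OF s wPm Gm[OF phi]]) (use pos pt in auto)
    then have "ereal (w * N - 2 * pi * (200 * (w * R))) \<le> p_norm s (G \<phi>)"
      by (cases "p_norm s (G \<phi>)") auto
    then have "ereal (1 / pi) * ereal (w * N - 2 * pi * (200 * (w * R))) \<le> ereal (1 / pi) * p_norm s (G \<phi>)"
      by (intro ereal_mult_left_mono) auto
    also have "\<dots> \<le> E" unfolding E_def err G1[OF phi, symmetric] by (rule SUP_upper[OF phi])
    finally have "ereal (1 / pi * (w * N - 2 * pi * (200 * (w * R)))) \<le> E" by simp
    moreover have "1 / pi * (w * N - 2 * pi * (200 * (w * R))) = w * (N / pi) - 400 * (w * R)"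
      by (simp add: field_simps)
    ultimately show ?thesis by simp
  qed
  obtain e where e: "E = ereal e" using up lo by (cases E) auto
  have "\<bar>e - w * (N / pi)\<bar> \<le> 400 * (w * R)" using up lo pos e by (auto simp: abs_le_iff)
  then show ?thesis using that[of e] e by (simp add: E_def w_def R_def mult_ac)
qed

text \<open>Exchanging \<open>N\<close> for \<open>M\<close> costs at most
  \<open>18 * pi < 72\<close> on the scale \<open>n / r\<^sup>2\<close>; with the 400 from the
  convolution this stays below 500. \<open>\<theta>\<close> is the error divided by its
  scale.\<close>

lemma fourier_error_theta:
  fixes r \<beta> :: real
  assumes n: "n \<ge> 1" and r: "2 \<le> r" "r \<le> real n + 1" and s: "s \<ge> 1"
  defines "q \<equiv> exp (- (r / real n))"
  assumes N: "p_norm s (geom_kernel q n (\<beta> * pi / 2)) = ereal N"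
    and M: "\<bar>N - M\<bar> \<le> 2 * pi * (pi / real n / (1 - q)\<^sup>2)"
  shows "\<exists>\<theta>. \<bar>\<theta>\<bar> \<le> 500 \<and> fourier_error n (weyl_nagy_class r \<beta>) s =
    ereal (real n powr (- r) * (M / pi + \<theta> * real n * r powr (- 2)))"
proof -
  define w where "w = real n powr (- r)"
  define R where "R = real n / r\<^sup>2"
  have pos: "w > 0" "R > 0" using n r by (auto simp: w_def R_def)
  obtain E where E: "fourier_error n (weyl_nagy_class r \<beta>) s = ereal E"
    "\<bar>E - w * (N / pi)\<bar> \<le> w * (400 * R)"
    using fourier_error_geometric[OF n r s N[unfolded q_def]] by (auto simp: w_def R_def)
  have q3: "1 / (1 - q)\<^sup>2 \<le> 9 * (real n / r)\<^sup>2"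
    unfolding q_def using n r by (intro inverse_one_minus_exp_square_le) auto
  have "\<bar>N - M\<bar> \<le> 2 * pi * pi / real n * (1 / (1 - q)\<^sup>2)" using M by simp
  also have "\<dots> \<le> 2 * pi * pi / real n * (9 * (real n / r)\<^sup>2)" using q3 by (intro mult_left_mono) auto
  also have "\<dots> = 18 * pi * R * pi" using n by (simp add: R_def power_divide power2_eq_square)
  also have "\<dots> \<le> 18 * 4 * R * pi"
    using pos pi_less_4 by (intro mult_right_mono mult_left_mono) auto
  finally have "\<bar>N - M\<bar> / pi \<le> 72 * R" by (simp add: divide_le_eq)
  then have "\<bar>N / pi - M / pi\<bar> \<le> 72 * R" by (simp add: diff_divide_distrib[symmetric] abs_divide)
  then have "\<bar>w * (N / pi) - w * (M / pi)\<bar> \<le> w * (72 * R)"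
    unfolding right_diff_distrib[symmetric] abs_mult using pos by simp
  then have d: "\<bar>E - w * (M / pi)\<bar> \<le> 500 * (w * R)" 
  proof -
    have aux: "\<bar>e - b\<bar> \<le> 500 * y" if "\<bar>a - b\<bar> \<le> 72 * y" "\<bar>e - a\<bar> \<le> 400 * y" "y > 0"
      for a b e y :: real using that by linarith
    assume "\<bar>w * (N / pi) - w * (M / pi)\<bar> \<le> w * (72 * R)"
    then show ?thesis using E(2) mult_pos_pos[OF pos]
      by (intro aux[of "w * (N / pi)"]) (simp_all only: mult.left_commute)
  qed
  define \<theta> where "\<theta> = (E - w * (M / pi)) / (w * R)"
  have "\<bar>\<theta>\<bar> \<le> 500" using d pos by (simp add: \<theta>_def abs_divide abs_mult divide_le_eq)
  moreover have "w * (M / pi + \<theta> * real n * r powr (- 2)) = E"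
  proof -
    have "real n * r powr (- 2) = R"
      using r by (simp add: R_def powr_minus inverse_eq_divide)
    then have "w * (M / pi + \<theta> * real n * r powr (- 2)) = w * (M / pi + \<theta> * R)"
      by (simp only: mult.assoc)
    also have "\<dots> = E" using pos by (simp add: \<theta>_def field_simps)
    finally show ?thesis .
  qed
  ultimately show ?thesis using E(1) unfolding w_def by blast
qed

lemma fourier_error_finite:
  fixes r \<beta> p :: real
  assumes n: "n \<ge> 1" and r: "2 \<le> r" "r \<le> real n + 1" and p: "p \<ge> 1"
  shows "\<exists>\<theta>. \<bar>\<theta>\<bar> \<le> 500 \<and> fourier_error n (weyl_nagy_class r \<beta>) (ereal p) =
    ereal (real n powr (- r) *
      (real_of_ereal (p_norm (ereal p) cos) / pi
         * gauss_hypergeometric (p / 2) (p / 2) 1 (exp (- 2 * r / real n)) powr (1 / p)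
       + \<theta> * real n * r powr (- 2)))"
proof -
  define q where "q = exp (- (r / real n))"
  have q: "0 \<le> q" "q < 1" using r n by (auto simp: q_def)
  have "q\<^sup>2 = exp (- 2 * r / real n)"
    by (simp add: q_def power2_eq_square exp_add[symmetric])
  then obtain N where "p_norm (ereal p) (geom_kernel q n (\<beta> * pi / 2)) = ereal N"
    "\<bar>N - real_of_ereal (p_norm (ereal p) cos) *
        gauss_hypergeometric (p / 2) (p / 2) 1 (exp (- 2 * r / real n)) powr (1 / p)\<bar>
      \<le> 2 * pi * (pi / real n / (1 - q)\<^sup>2)"
    using p_norm_geom_kernel[OF q n p, of "\<beta> * pi / 2"] by auto
  from fourier_error_theta[OF n r _ this[unfolded q_def]] p
  show ?thesis by (simp add: one_ereal_def)
qed

lemma fourier_error_infinity: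
  fixes r \<beta> :: real
  assumes n: "n \<ge> 1" and r: "2 \<le> r" "r \<le> real n + 1"
  shows "\<exists>\<theta>. \<bar>\<theta>\<bar> \<le> 500 \<and> fourier_error n (weyl_nagy_class r \<beta>) \<infinity> =
    ereal (real n powr (- r) * (1 / (pi * (1 - exp (- r / real n))) + \<theta> * real n * r powr (- 2)))"
proof -
  define q where "q = exp (- (r / real n))"
  have q: "0 \<le> q" "q < 1" using r n by (auto simp: q_def)
  obtain N where "p_norm \<infinity> (geom_kernel q n (\<beta> * pi / 2)) = ereal N"
    "\<bar>N - 1 / (1 - q)\<bar> \<le> 2 * pi * (pi / real n / (1 - q)\<^sup>2)"
    using p_norm_geom_kernel_infinity[OF q n, of "\<beta> * pi / 2"] by auto
  from fourier_error_theta[OF n r _ this[unfolded q_def]]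
  show ?thesis by (simp add: mult.commute[of pi])
qed

theorem theorem3:
  shows "\<exists>C::real. \<forall>(\<beta>::real) (r::real) (n::nat).
    n \<ge> 1 \<and> r > 1 \<and> sqrt (real n) + 1 \<le> r \<and> r \<le> real n + 1 \<longrightarrow>
      (\<forall>p::real. p \<ge> 1 \<longrightarrow>
        (\<exists>\<theta>::real. \<bar>\<theta>\<bar> \<le> C \<and>
          fourier_error n (weyl_nagy_class r \<beta>) (ereal p) =
            ereal (real n powr (- r) *
              (real_of_ereal (p_norm (ereal p) cos) / pi
                 * gauss_hypergeometric (p / 2) (p / 2) 1 (exp (- 2 * r / real n)) powr (1 / p)
               + \<theta> * real n * r powr (- 2))))) \<and>
      (\<exists>\<theta>::real. \<bar>\<theta>\<bar> \<le> C \<and>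
        fourier_error n (weyl_nagy_class r \<beta>) \<infinity> =
          ereal (real n powr (- r) *
            (1 / (pi * (1 - exp (- r / real n))) + \<theta> * real n * r powr (- 2))))"
proof (intro exI[of _ 500] allI impI, goal_cases)
  case (1 \<beta> r n)
  \<comment> \<open>The range of \<open>r\<close> provides \<open>2 \<le> r\<close>, as the
    comparison of the coefficients with the geometric sequence requires.\<close>
  then have "1 \<le> sqrt (real n)" by simp
  with 1 have "2 \<le> r" by linarith
  with 1 show ?case by (intro conjI allI impI fourier_error_finite fourier_error_infinity) auto
qed

end
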